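(* Let $n\ge 1$, let $u\in C^\infty(\mathbb{R}^n)\cap L^\infty(\mathbb{R}^n)$ and let $0<s\le 2$. Then $u$ solves $(-\Delta)^s u=u$ in $\mathbb{R}^n$ if and only if $-\Delta u=u$ in $\mathbb{R}^n$.
   Context: The operator $(-\Delta)^s$ is the operator with Fourier multiplier $|\xi|^{2s}$, i.e. $\widehat{(-\Delta)^s u}(\xi)=|\xi|^{2s}\hat u(\xi)$, understood in the distributional sense: for $u\in L^\infty(\mathbb{R}^n)$, $\langle (-\Delta)^s u,\phi\rangle=\int_{\mathbb{R}^n}u\,(-\Delta)^s\phi\,dx$ for test functions $\phi$. For $u\in C^\infty(\mathbb{R}^n)\cap L^\infty(\mathbb{R}^n)$ it is also given, with normalization constants making the multiplier equal to $|\xi|^{2s}$, by $c_{n,s}\,\mathrm{P.V.}\int_{\mathbb{R}^n}\frac{u(x)-u(y)}{|x-y|^{n+2s}}\,dy$ when $0<s<1$ and by $c_{n,2,s}\int_{\mathbb{R}^n}\frac{u(x-2y)-4u(x-y)+6u(x)-4u(x+y)+u(x+2y)}{|y|^{n+2s}}\,dy$ when $1<s<2$; for $s=1,2$ it is the classical operator $-\Delta$, $\Delta^2$. *)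

theory Defs
  imports "HOL-Analysis.Analysis"
begin

definition partial_deriv :: "'a::euclidean_space \<Rightarrow> ('a \<Rightarrow> complex) \<Rightarrow> 'a \<Rightarrow> complex" where
  "partial_deriv b f x = frechet_derivative f (at x) b"

definition laplacian :: "('a::euclidean_space \<Rightarrow> complex) \<Rightarrow> 'a \<Rightarrow> complex" where
  "laplacian f x = (\<Sum>b\<in>Basis. partial_deriv b (partial_deriv b f) x)"

text \<open>
  \<^term>\<open>foldr partial_deriv bs f\<close> is the iterated partial derivative of \<^term>\<open>f\<close> along the list
  \<^term>\<open>bs\<close> of basis vectors. Total differentiability of all of them (the empty list gives
  \<^term>\<open>f\<close> itself) yields their continuity, so this is the usual class of smooth functions.
\<close>

definition smooth :: "('a::euclidean_space \<Rightarrow> complex) \<Rightarrow> bool" where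
  "smooth f \<longleftrightarrow>
     (\<forall>bs. set bs \<subseteq> Basis \<longrightarrow> (\<forall>x. (foldr partial_deriv bs f) differentiable (at x)))"

definition L_infinity :: "('a::euclidean_space \<Rightarrow> complex) \<Rightarrow> bool" where
  "L_infinity f \<longleftrightarrow> f \<in> borel_measurable lborel \<and> (\<exists>C. AE x in lborel. norm (f x) \<le> C)"

definition test_function :: "('a::euclidean_space \<Rightarrow> complex) \<Rightarrow> bool" where
  "test_function \<phi> \<longleftrightarrow> smooth \<phi> \<and> compact (closure {x. \<phi> x \<noteq> 0})"

definition fourier :: "('a::euclidean_space \<Rightarrow> complex) \<Rightarrow> 'a \<Rightarrow> complex" where
  "fourier f \<xi> = (LINT x|lborel. f x * cis (- (x \<bullet> \<xi>)))"

definition inverse_fourier :: "('a::euclidean_space \<Rightarrow> complex) \<Rightarrow> 'a \<Rightarrow> complex" where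
  "inverse_fourier g x =
     (LINT \<xi>|lborel. g \<xi> * cis (x \<bullet> \<xi>)) / of_real ((2 * pi) ^ DIM('a))"

text \<open>
  The operator with Fourier multiplier \<open>|\<xi>|\<^sup>2\<^sup>s\<close>, acting on test functions. For \<open>s > 0\<close> all
  integrals converge absolutely: the Fourier transform of a test function decays rapidly.
\<close>

definition frac_laplacian_test ::
  "real \<Rightarrow> ('a::euclidean_space \<Rightarrow> complex) \<Rightarrow> 'a \<Rightarrow> complex" where
  "frac_laplacian_test s \<phi> =
     inverse_fourier (\<lambda>\<xi>. of_real (norm \<xi> powr (2 * s)) * fourier \<phi> \<xi>)"

text \<open>
  Distributions are represented as functionals on test functions; the pairing is bilinear
  (no complex conjugation). For \<open>s > 0\<close>, \<^term>\<open>frac_laplacian_test s \<phi>\<close> is integrable for each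
  test function \<open>\<phi>\<close>, so the pairing with a bounded function converges absolutely.
\<close>

definition distribution_of ::
  "('a::euclidean_space \<Rightarrow> complex) \<Rightarrow> ('a \<Rightarrow> complex) \<Rightarrow> complex" where
  "distribution_of u \<phi> = (LINT x|lborel. u x * \<phi> x)"

definition frac_laplacian ::
  "real \<Rightarrow> ('a::euclidean_space \<Rightarrow> complex) \<Rightarrow> ('a \<Rightarrow> complex) \<Rightarrow> complex" where
  "frac_laplacian s u \<phi> = (LINT x|lborel. u x * frac_laplacian_test s \<phi> x)"

definition solves_frac_helmholtz :: "real \<Rightarrow> ('a::euclidean_space \<Rightarrow> complex) \<Rightarrow> bool" where
  "solves_frac_helmholtz s u \<longleftrightarrow>
     (\<forall>\<phi>. test_function \<phi> \<longrightarrow> frac_laplacian s u \<phi> = distribution_of u \<phi>)"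

end

theory Submission
  imports Defs "HOL-Probability.Probability"
begin

text \<open>
  Write \<open>A = -\<Delta>\<close>. All operators in question are functions of \<open>A\<close>, and formally \<open>A\<^sup>s u = u\<close> should force the
  spectrum of \<open>u\<close> to be the root \<open>1\<close> of \<open>l\<^sup>s = 1\<close>. The symbol \<open>|\<xi>|\<^sup>2\<^sup>s\<close> is singular at the origin, so the
  tempered distribution \<open>\<hat>u\<close> cannot simply be multiplied by it. The proof therefore replaces spectral
  arguments for \<open>u\<close> by the heat flow: for a test function \<open>f\<close> it studies the bounded function
  \<open>d(t) = \<langle>u, exp (-t A) f\<rangle>\<close> on the half-line, on which \<open>A\<close> acts as \<open>-d/dt\<close>. For \<open>0 < s < 1\<close> the formula
  \<open>l\<^sup>s = c\<^sub>s \<integral>\<^sub>0\<^sup>\<infinity> (1 - exp (-r l)) r\<^bsup>-1-s\<^esup> dr\<close> turns \<open>A\<^sup>s\<close> into an integral over the heat flow, and the contraction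
  property of the heat flow on \<open>L\<^sup>1\<close> makes all pairings with the bounded function \<open>u\<close> converge.
  
  From \<open>A\<^sup>s u = u\<close> to \<open>A u = u\<close>: the factorisation \<open>A\<^sup>s - 1 = (A\<^bsup>s/2\<^esup> + 1) (A\<^bsup>s/2\<^esup> - 1)\<close> and the injectivity of
  \<open>A\<^bsup>s/2\<^esup> + 1\<close>, a maximum principle on the half-line for \<open>s/2 < 1\<close> (\<open>fractional_maximum_principle\<close>) and
  the absence of bounded solutions of \<open>d' = d\<close> for \<open>s/2 = 1\<close>, give
  \<open>A\<^bsup>s/2\<^esup> u = u\<close> (\<open>solution_symbols_half\<close>). Iterating and taking powers yields \<open>A\<^sup>\<sigma> u = u\<close> for all \<open>\<sigma>\<close> of the form
  \<open>j s / 2\<^sup>k\<close>. These are dense, so the equation holds for \<open>\<sigma> = 1/2\<close> by continuity, and then for \<open>\<sigma> = 1\<close>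
  (\<open>solution_symbols_imp_helmholtz\<close>).
  
  From \<open>A u = u\<close> to \<open>A\<^sup>s u = u\<close>: now \<open>d' = -d\<close>, so \<open>d\<close> is a multiple of \<open>exp (-t)\<close>, and the integral formula gives
  \<open>A\<^sup>s u = u\<close> for \<open>s < 1\<close>; the remaining exponents are \<open>1\<close> plus such an exponent, or \<open>1\<close> or \<open>2\<close>
  (\<open>helmholtz_imp_solution_symbols\<close>).
  
  The identities between operators are proved on the Fourier side, for a class of symbols that
  contains the transforms of test functions and is stable under all \<open>A\<^sup>s\<close>. Test functions enter
  through two facts: their Fourier transforms decay rapidly, and Fourier inversion holds for them.
\<close>

section \<open>Smooth functions and test functions\<close>

text \<open>
  Smoothness speaks about all lists of partial derivatives. A class of differentiable functions
  that is closed under partial derivatives consists of smooth functions, so a smoothness proof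
  amounts to exhibiting such a class.
\<close>

lemma smooth_coinduct:
  assumes "f \<in> C"
    and diff: "\<And>f x. f \<in> C \<Longrightarrow> f differentiable (at x)"
    and pd: "\<And>f b. f \<in> C \<Longrightarrow> b \<in> Basis \<Longrightarrow> partial_deriv b f \<in> C"
  shows "smooth f"
proof -
  have "foldr partial_deriv bs f \<in> C" if "set bs \<subseteq> Basis" for bs
    using that by (induction bs) (auto simp: assms)
  then show ?thesis using diff by (auto simp: smooth_def)
qed

lemma smooth_imp_differentiable: "smooth f \<Longrightarrow> f differentiable (at x)"
  unfolding smooth_def by (metis foldr.simps(1) id_apply empty_set empty_subsetI)

lemma smooth_partial_deriv:
  fixes f :: "'a::euclidean_space \<Rightarrow> complex"
  shows "smooth f \<Longrightarrow> b \<in> Basis \<Longrightarrow> smooth (partial_deriv b f)"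
  unfolding smooth_def
proof (intro allI impI)
  fix bs :: "'a list" and x assume a: "\<forall>bs. set bs \<subseteq> Basis \<longrightarrow> (\<forall>x. foldr partial_deriv bs f differentiable at x)"
    "b \<in> Basis" "set bs \<subseteq> Basis"
  show "foldr partial_deriv bs (partial_deriv b f) differentiable at x"
    using a(1)[rule_format, of "bs @ [b]" x] a by simp
qed

lemma smooth_imp_continuous_on: "smooth f \<Longrightarrow> continuous_on A f"
  by (meson smooth_imp_differentiable differentiable_imp_continuous_on differentiable_at_imp_differentiable_on)

lemma smooth_imp_borel_measurable [measurable_dest]: "smooth f \<Longrightarrow> f \<in> borel_measurable borel"
  by (intro borel_measurable_continuous_onI smooth_imp_continuous_on)

lemma partial_deriv_eqI: "(f has_derivative f') (at x) \<Longrightarrow> partial_deriv b f x = f' b"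
  by (simp add: partial_deriv_def frechet_derivative_at[symmetric])

lemma has_derivative_frechet:
  "f differentiable (at x) \<Longrightarrow> (f has_derivative frechet_derivative f (at x)) (at x)"
  by (simp add: frechet_derivative_works)

lemma partial_deriv_add:
  "f differentiable (at x) \<Longrightarrow> g differentiable (at x) \<Longrightarrow>
   partial_deriv b (\<lambda>x. f x + g x) x = partial_deriv b f x + partial_deriv b g x"
  by (rule partial_deriv_eqI[THEN trans])
     (auto intro!: has_derivative_add has_derivative_frechet simp: partial_deriv_def)

lemma partial_deriv_diff:
  "f differentiable (at x) \<Longrightarrow> g differentiable (at x) \<Longrightarrow>
   partial_deriv b (\<lambda>x. f x - g x) x = partial_deriv b f x - partial_deriv b g x"
  by (rule partial_deriv_eqI[THEN trans])
     (auto intro!: has_derivative_diff has_derivative_frechet simp: partial_deriv_def)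

lemma partial_deriv_mult:
  "f differentiable (at x) \<Longrightarrow> g differentiable (at x) \<Longrightarrow>
   partial_deriv b (\<lambda>x. f x * g x) x = f x * partial_deriv b g x + partial_deriv b f x * g x"
  by (rule partial_deriv_eqI[THEN trans])
     (auto intro!: has_derivative_mult has_derivative_frechet simp: partial_deriv_def)

lemma partial_deriv_sum:
  "finite I \<Longrightarrow> (\<And>i. i \<in> I \<Longrightarrow> f i differentiable (at x)) \<Longrightarrow>
   partial_deriv b (\<lambda>x. \<Sum>i\<in>I. f i x) x = (\<Sum>i\<in>I. partial_deriv b (f i) x)"
  by (rule partial_deriv_eqI[THEN trans])
     (auto intro!: has_derivative_sum has_derivative_frechet simp: partial_deriv_def)

lemma smooth_sum:
  assumes "finite I" "\<And>i. i \<in> I \<Longrightarrow> smooth (f i)"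
  shows "smooth (\<lambda>x. \<Sum>i\<in>I. f i x)"
proof -
  have c: "smooth f" if "f \<in> {\<lambda>x. \<Sum>i\<in>I. f i x | f. \<forall>i\<in>I. smooth (f i)}" for f :: "'b \<Rightarrow> complex"
    using that
  proof (rule smooth_coinduct, goal_cases)
    case (1 h x)
    then show ?case using assms(1) by (auto intro!: differentiable_sum intro: smooth_imp_differentiable)
  next
    case (2 h b)
    then obtain f where f: "h = (\<lambda>x. \<Sum>i\<in>I. f i x)" "\<forall>i\<in>I. smooth (f i)" by auto
    have "partial_deriv b h = (\<lambda>x. \<Sum>i\<in>I. partial_deriv b (f i) x)"
      unfolding f(1) using f assms(1) by (intro ext partial_deriv_sum) (auto intro: smooth_imp_differentiable)
    with f 2 show ?case by (auto intro!: exI[of _ "\<lambda>i. partial_deriv b (f i)"] smooth_partial_deriv)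
  qed
  show ?thesis by (rule c) (use assms in auto)
qed

lemma smooth_add: "smooth f \<Longrightarrow> smooth g \<Longrightarrow> smooth (\<lambda>x. f x + g x)"
  using smooth_sum[of UNIV "\<lambda>i. if i then f else g"] by (simp add: UNIV_bool add.commute)

lemma smooth_uminus:
  assumes "smooth f"
  shows "smooth (\<lambda>x. - f x)"
proof (rule smooth_coinduct[where C = "{\<lambda>x. - f x | f. smooth f}"], goal_cases)
  case 1
  then show ?case using assms by auto
next
  case (2 h x)
  then show ?case by (auto intro!: differentiable_minus intro: smooth_imp_differentiable)
next
  case (3 h b)
  then obtain f where f: "h = (\<lambda>x. - f x)" "smooth f" by auto
  have "partial_deriv b h = (\<lambda>x. - partial_deriv b f x)"
    unfolding f(1) using f
    by (intro ext partial_deriv_eqI[THEN trans])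
       (auto intro!: has_derivative_minus has_derivative_frechet smooth_imp_differentiable simp: partial_deriv_def)
  with f 3 show ?case by (auto intro!: exI[of _ "partial_deriv b f"] smooth_partial_deriv)
qed

lemma partial_deriv_translate:
  fixes f :: "'a::euclidean_space \<Rightarrow> complex"
  assumes "smooth f"
  shows "partial_deriv b (\<lambda>x. f (x - a)) = (\<lambda>x. partial_deriv b f (x - a))"
proof
  fix x
  have "((\<lambda>x. f (x - a)) has_derivative (\<lambda>h. frechet_derivative f (at (x - a)) h)) (at x)"
    by (rule has_derivative_compose[where f = "\<lambda>x. x - a" and g = f, of "\<lambda>h. h"])
       (auto intro!: derivative_eq_intros has_derivative_frechet smooth_imp_differentiable assms)
  then show "partial_deriv b (\<lambda>x. f (x - a)) x = partial_deriv b f (x - a)"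
    by (simp add: partial_deriv_eqI) (simp add: partial_deriv_def)
qed

lemma smooth_translate:
  fixes f :: "'a::euclidean_space \<Rightarrow> complex"
  assumes "smooth f"
  shows "smooth (\<lambda>x. f (x - a))"
proof (rule smooth_coinduct[where C = "{\<lambda>x. f (x - a) | f. smooth f}"], goal_cases)
  case 1
  then show ?case using assms by auto
next
  case (2 h x)
  then obtain f where f: "h = (\<lambda>x. f (x - a))" "smooth f" by auto
  show ?case unfolding f(1)
    by (rule differentiable_compose[where f = f and g = "\<lambda>x. x - a"])
       (use f in \<open>auto intro!: smooth_imp_differentiable\<close>)
next
  case (3 h b)
  then show ?case using partial_deriv_translate smooth_partial_deriv by fastforce
qed

lemma smooth_laplacian: "smooth f \<Longrightarrow> smooth (laplacian f)"
  unfolding laplacian_def[abs_def]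
  by (intro smooth_sum smooth_partial_deriv) auto

text \<open>
  Vanishing outside of some ball is easier to transport through derivatives, sums and translations
  than compactness of the closed support.
\<close>

lemma test_function_iff:
  "test_function f \<longleftrightarrow> smooth f \<and> (\<exists>R. \<forall>x. R < norm x \<longrightarrow> f x = 0)"
proof -
  have "compact (closure {x. f x \<noteq> 0}) \<longleftrightarrow> (\<exists>R. \<forall>x. R < norm x \<longrightarrow> f x = 0)"
    unfolding compact_closure bounded_iff by (metis (mono_tags, lifting) mem_Collect_eq not_le)
  then show ?thesis by (simp add: test_function_def)
qed

lemma partial_deriv_eq_0_outside:
  fixes f :: "'a::euclidean_space \<Rightarrow> complex"
  assumes "\<And>x. R < norm x \<Longrightarrow> f x = 0" "R < norm x"
  shows "partial_deriv b f x = 0"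
proof -
  have o: "open {x::'a. R < norm x}" by (intro open_Collect_less continuous_intros)
  have "(f has_derivative (\<lambda>h. 0)) (at x)"
    by (rule has_derivative_transform_within_open[of "\<lambda>x. 0" _ _ _ "{x. R < norm x}"])
       (use assms o in auto)
  then show ?thesis by (simp add: partial_deriv_eqI)
qed

lemma test_function_laplacian:
  assumes "test_function f"
  shows "test_function (laplacian f)"
proof -
  from assms obtain R where R: "\<And>x. R < norm x \<Longrightarrow> f x = 0" and s: "smooth f"
    by (auto simp: test_function_iff)
  have R': "partial_deriv b f x = 0" if "R < norm x" for b x
    by (rule partial_deriv_eq_0_outside[OF R that])
  have "laplacian f x = 0" if "R < norm x" for x
    unfolding laplacian_def by (intro sum.neutral ballI partial_deriv_eq_0_outside[OF R' that])
  with s show ?thesis by (auto simp: test_function_iff smooth_laplacian)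
qed

lemma test_function_uminus: "test_function f \<Longrightarrow> test_function (\<lambda>x. - f x)"
  by (auto simp: test_function_iff smooth_uminus)

lemma test_function_translate:
  fixes f :: "'a::euclidean_space \<Rightarrow> complex"
  assumes "test_function f"
  shows "test_function (\<lambda>x. f (x - a))"
proof -
  from assms obtain R where R: "\<And>x. R < norm x \<Longrightarrow> f x = 0" and s: "smooth f"
    by (auto simp: test_function_iff)
  have "f (x - a) = 0" if "R + norm a < norm x" for x
    by (rule R) (use that norm_triangle_ineq2[of x a] in linarith)
  with s show ?thesis by (auto simp: test_function_iff smooth_translate)
qed

lemma
  fixes f :: "'a::euclidean_space \<Rightarrow> 'b::{banach, second_countable_topology}"
  assumes c: "c \<noteq> 0" and f: "integrable lborel f"
  shows lborel_integrable_affine: "integrable lborel (\<lambda>x. f (a + c *\<^sub>R x))"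
    and lborel_integral_affine:
      "(LINT x|lborel. f x) = \<bar>c\<bar> ^ DIM('a) *\<^sub>R (LINT x|lborel. f (a + c *\<^sub>R x))"
proof -
  have [measurable]: "f \<in> borel_measurable borel" using f by auto
  have "integrable (density (distr lborel borel (\<lambda>x. a + c *\<^sub>R x)) (\<lambda>_. ennreal (\<bar>c\<bar> ^ DIM('a)))) f"
    using f lborel_affine[OF c, of a] by simp
  then have "integrable lborel (\<lambda>x. \<bar>c\<bar> ^ DIM('a) *\<^sub>R f (a + c *\<^sub>R x))"
    by (simp add: integrable_density integrable_distr_eq)
  from integrable_scaleR_right[OF this, of "inverse (\<bar>c\<bar> ^ DIM('a))"]
  show "integrable lborel (\<lambda>x. f (a + c *\<^sub>R x))"
    using c by simp
  have "(LINT x|lborel. f x)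
      = (LINT x|density (distr lborel borel (\<lambda>x. a + c *\<^sub>R x)) (\<lambda>_. ennreal (\<bar>c\<bar> ^ DIM('a))). f x)"
    using lborel_affine[OF c, of a] by simp
  also have "\<dots> = \<bar>c\<bar> ^ DIM('a) *\<^sub>R (LINT x|lborel. f (a + c *\<^sub>R x))"
    by (simp add: integral_density integral_distr)
  finally show "(LINT x|lborel. f x) = \<bar>c\<bar> ^ DIM('a) *\<^sub>R (LINT x|lborel. f (a + c *\<^sub>R x))" .
qed

lemma integrable_compact_support:
  fixes f :: "'a::euclidean_space \<Rightarrow> complex"
  assumes "continuous_on UNIV f" "\<And>x. R < norm x \<Longrightarrow> f x = 0"
  shows "integrable lborel f"
proof -
  have "integrable lborel (\<lambda>x. indicator (cball 0 R) x *\<^sub>R f x)"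
    by (rule borel_integrable_compact) (use assms(1) in \<open>auto intro: continuous_on_subset\<close>)
  also have "(\<lambda>x. indicator (cball 0 R) x *\<^sub>R f x) = f"
    using assms(2) by (auto simp: indicator_def fun_eq_iff not_le dest: leI)
  finally show ?thesis .
qed

lemma test_function_integrable: "test_function f \<Longrightarrow> integrable lborel f"
  unfolding test_function_iff using integrable_compact_support smooth_imp_continuous_on by blast

lemma test_function_bounded:
  assumes "test_function f"
  obtains M where "\<And>x. norm (f x) \<le> M"
proof -
  from assms obtain R where R: "\<And>x. R < norm x \<Longrightarrow> f x = 0" and s: "smooth f"
    by (auto simp: test_function_iff)
  have "compact (f ` cball 0 R)"
    by (intro compact_continuous_image smooth_imp_continuous_on s compact_cball)
  then obtain M where M: "\<And>x. x \<in> cball 0 R \<Longrightarrow> norm (f x) \<le> M"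
    using compact_imp_bounded bounded_iff by (metis imageI)
  have "norm (f x) \<le> max M 0" for x
  proof (cases "R < norm x")
    case True
    then show ?thesis using R[of x] by simp
  next
    case False
    then show ?thesis using M[of x] by simp
  qed
  then show ?thesis using that by blast
qed

section \<open>Integration by parts\<close>

text \<open>
  Lebesgue measure is invariant under translations, so each difference quotient of \<open>f\<close> in direction
  \<open>b\<close> has integral zero. By the mean value inequality these quotients are bounded by a multiple of
  the indicator function of a ball, and dominated convergence yields the claim for the derivative.
\<close>

lemma integral_partial_deriv_eq_0:
  fixes f :: "'a::euclidean_space \<Rightarrow> complex"
  assumes diff: "\<And>x. f differentiable (at x)"
    and cont: "continuous_on UNIV (partial_deriv b f)"
    and supp: "\<And>x. R < norm x \<Longrightarrow> f x = 0" and b: "b \<in> Basis"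
  shows "(LINT x|lborel. partial_deriv b f x) = 0"
proof -
  define g where "g = partial_deriv b f"
  define h where "h i = inverse (real (Suc i))" for i
  have h: "0 < h i" "h i \<le> 1" for i by (auto simp: h_def divide_simps)
  have nb: "norm b = 1" using b by simp
  have fc: "continuous_on UNIV f"
    using diff by (simp add: differentiable_imp_continuous_on differentiable_at_imp_differentiable_on)
  have g0: "g x = 0" if "R < norm x" for x
    unfolding g_def using partial_deriv_eq_0_outside[of R f] supp that by blast
  obtain M0 where M0: "\<And>x. x \<in> cball 0 R \<Longrightarrow> norm (g x) \<le> M0"
    using compact_continuous_image[OF continuous_on_subset[OF cont subset_UNIV] compact_cball]
      compact_imp_bounded bounded_iff unfolding g_def by (metis imageI)
  define M where "M = max M0 0"
  have M: "norm (g x) \<le> M" for x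
    using M0[of x] g0[of x] by (cases "R < norm x") (auto simp: M_def)
  \<comment> \<open>Along the line through \<open>x\<close> in direction \<open>b\<close>, the function \<open>f\<close> has derivative \<open>g\<close>.\<close>
  have line: "((\<lambda>t. f (x + t *\<^sub>R b)) has_vector_derivative g (x + t *\<^sub>R b)) (at t within S)" for x t S
  proof -
    have "((\<lambda>t. f (x + t *\<^sub>R b)) has_derivative
        (\<lambda>t'. frechet_derivative f (at (x + t *\<^sub>R b)) (t' *\<^sub>R b))) (at t)"
      by (rule has_derivative_compose[where f = "\<lambda>t. x + t *\<^sub>R b" and g = f])
         (auto intro!: derivative_eq_intros has_derivative_frechet diff)
    moreover have "linear (frechet_derivative f (at (x + t *\<^sub>R b)))"
      using diff by (simp add: linear_frechet_derivative)
    ultimately show ?thesis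
      by (simp add: has_vector_derivative_def g_def partial_deriv_def linear_cmul has_derivative_at_withinI)
  qed
  have quot: "norm ((f (x + h i *\<^sub>R b) - f x) /\<^sub>R h i) \<le> M" for x i
  proof -
    have "norm (f (x + h i *\<^sub>R b) - f (x + 0 *\<^sub>R b)) \<le> M * norm (h i - 0)"
    proof (rule differentiable_bound[of "{0..h i}" "\<lambda>t. f (x + t *\<^sub>R b)" "\<lambda>t h. h *\<^sub>R g (x + t *\<^sub>R b)" M])
      show "onorm (\<lambda>h. h *\<^sub>R g (x + t *\<^sub>R b)) \<le> M" for t
        using M by (intro onorm_le) (simp add: mult_right_mono mult.commute[of M] mult_left_mono)
    qed (use line h[of i] in \<open>auto simp: has_vector_derivative_def\<close>)
    then show ?thesis using h(1)[of i] by (simp add: divide_simps mult.commute)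
  qed
  have "(\<lambda>i. LINT x|lborel. (f (x + h i *\<^sub>R b) - f x) /\<^sub>R h i) \<longlonglongrightarrow> (LINT x|lborel. g x)"
  proof (rule integral_dominated_convergence[where w = "\<lambda>x. indicator (cball 0 (R + 1)) x * M"])
    show "g \<in> borel_measurable lborel"
      using cont unfolding g_def by (simp add: borel_measurable_continuous_onI)
    have [measurable]: "f \<in> borel_measurable borel"
      using fc by (simp add: borel_measurable_continuous_onI)
    show "(\<lambda>x. (f (x + h i *\<^sub>R b) - f x) /\<^sub>R h i) \<in> borel_measurable lborel" for i by measurable
    have "integrable lborel (\<lambda>x. indicator (cball 0 (R + 1)) x *\<^sub>R M)"
      by (rule borel_integrable_compact) auto
    then show "integrable lborel (\<lambda>x::'a. indicator (cball 0 (R + 1)) x * M)" by simp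
    show "AE x in lborel. (\<lambda>i. (f (x + h i *\<^sub>R b) - f x) /\<^sub>R h i) \<longlonglongrightarrow> g x"
    proof (rule AE_I2)
      fix x
      have "((\<lambda>t. (f (x + t *\<^sub>R b) - f x - t *\<^sub>R g x) /\<^sub>R \<bar>t\<bar>) \<longlongrightarrow> 0) (at 0)"
        using line[of x 0 UNIV] by (auto simp: has_vector_derivative_def has_derivative_at_within)
      then have "((\<lambda>t. (f (x + t *\<^sub>R b) - f x) /\<^sub>R t - g x) \<longlongrightarrow> 0) (at 0)"
      proof (rule Lim_transform_eventually[OF tendsto_norm_zero, THEN tendsto_norm_zero_cancel])
        show "\<forall>\<^sub>F t in at 0. norm ((f (x + t *\<^sub>R b) - f x - t *\<^sub>R g x) /\<^sub>R \<bar>t\<bar>)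
            = norm ((f (x + t *\<^sub>R b) - f x) /\<^sub>R t - g x)"
        proof (rule eventually_at_filter[THEN iffD2], rule always_eventually, intro allI impI)
          fix t :: real assume "t \<noteq> 0"
          then have "(f (x + t *\<^sub>R b) - f x) /\<^sub>R t - g x = (f (x + t *\<^sub>R b) - f x - t *\<^sub>R g x) /\<^sub>R t"
            by (simp add: scaleR_diff_right)
          then show "norm ((f (x + t *\<^sub>R b) - f x - t *\<^sub>R g x) /\<^sub>R \<bar>t\<bar>)
            = norm ((f (x + t *\<^sub>R b) - f x) /\<^sub>R t - g x)" by simp
        qed
      qed
      then have "((\<lambda>t. (f (x + t *\<^sub>R b) - f x) /\<^sub>R t) \<longlongrightarrow> g x) (at 0)"
        by (simp add: LIM_zero_iff)
      moreover have "filterlim h (at 0) sequentially"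
        unfolding h_def by (rule filterlim_atI[OF LIMSEQ_inverse_real_of_nat]) simp
      ultimately show "(\<lambda>i. (f (x + h i *\<^sub>R b) - f x) /\<^sub>R h i) \<longlonglongrightarrow> g x"
        by (rule filterlim_compose)
    qed
    show "AE x in lborel. norm ((f (x + h i *\<^sub>R b) - f x) /\<^sub>R h i) \<le> indicator (cball 0 (R + 1)) x * M" for i
    proof (rule AE_I2)
      fix x
      show "norm ((f (x + h i *\<^sub>R b) - f x) /\<^sub>R h i) \<le> indicator (cball 0 (R + 1)) x * M"
      proof (cases "norm x \<le> R + 1")
        case True
        then show ?thesis using quot[of i x] by (simp add: indicator_def)
      next
        case False
        have "norm x \<le> norm (x + h i *\<^sub>R b) + norm (h i *\<^sub>R b)"
          using norm_triangle_ineq4[of "x + h i *\<^sub>R b" "h i *\<^sub>R b"] by simp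
        with False h[of i] nb have "R < norm (x + h i *\<^sub>R b)" "R < norm x" by auto
        then show ?thesis using supp False by simp
      qed
    qed
  qed
  moreover have "(LINT x|lborel. (f (x + h i *\<^sub>R b) - f x) /\<^sub>R h i) = 0" for i
  proof -
    have fi: "integrable lborel f" by (rule integrable_compact_support[OF fc supp])
    have "integrable lborel (\<lambda>x. f (x + h i *\<^sub>R b))" "(LINT x|lborel. f (x + h i *\<^sub>R b)) = (LINT x|lborel. f x)"
      using lborel_integrable_affine[of 1 f "h i *\<^sub>R b"] lborel_integral_affine[of 1 f "h i *\<^sub>R b"] fi
      by (simp_all add: add.commute)
    then show ?thesis using fi by simp
  qed
  ultimately show ?thesis by (simp only: g_def LIMSEQ_const_iff)
qed

text \<open>
  For each direction, the two integrands differ by the derivative of \<open>v \<partial>\<phi> - \<partial>v \<phi>\<close>, which has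
  compact support.
\<close>

lemma green_identity:
  fixes v :: "'a::euclidean_space \<Rightarrow> complex"
  assumes v: "smooth v" and \<phi>: "test_function \<phi>"
  shows "(LINT x|lborel. v x * laplacian \<phi> x) = (LINT x|lborel. laplacian v x * \<phi> x)"
proof -
  from \<phi> obtain R where R: "\<And>x. R < norm x \<Longrightarrow> \<phi> x = 0" and s: "smooth \<phi>"
    by (auto simp: test_function_iff)
  have R': "partial_deriv b \<phi> x = 0" if "R < norm x" for b x
    by (rule partial_deriv_eq_0_outside[OF R that])
  have R'': "partial_deriv b (partial_deriv b \<phi>) x = 0" if "R < norm x" for b x
    by (rule partial_deriv_eq_0_outside[OF R' that])
  have int: "integrable lborel (\<lambda>x. f x * g x)"
    if "smooth f" "smooth g" "\<And>x. R < norm x \<Longrightarrow> g x = 0" for f g :: "'a \<Rightarrow> complex"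
    by (rule integrable_compact_support[where R = R])
       (use that in \<open>auto intro!: continuous_intros intro: smooth_imp_continuous_on\<close>)
  have 1: "(LINT x|lborel. v x * partial_deriv b (partial_deriv b \<phi>) x)
      = (LINT x|lborel. partial_deriv b (partial_deriv b v) x * \<phi> x)" if b: "b \<in> Basis" for b
  proof -
    let ?F = "\<lambda>x. v x * partial_deriv b \<phi> x - partial_deriv b v x * \<phi> x"
    note [simp] = smooth_partial_deriv[OF _ b] v s smooth_imp_differentiable
    have F: "partial_deriv b ?F = (\<lambda>x. v x * partial_deriv b (partial_deriv b \<phi>) x
        - partial_deriv b (partial_deriv b v) x * \<phi> x)"
      by (rule ext) (simp add: partial_deriv_diff partial_deriv_mult)
    have "(LINT x|lborel. partial_deriv b ?F x) = 0"
      by (rule integral_partial_deriv_eq_0[where R = R])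
         (use b in \<open>auto simp: F R R' intro!: continuous_intros intro: smooth_imp_continuous_on\<close>)
    then show ?thesis unfolding F
      by (subst (asm) Bochner_Integration.integral_diff)
         (auto intro!: int simp: R R' R'')
  qed
  have "(LINT x|lborel. v x * laplacian \<phi> x)
      = (\<Sum>b\<in>Basis. LINT x|lborel. v x * partial_deriv b (partial_deriv b \<phi>) x)"
    unfolding laplacian_def sum_distrib_left
    by (rule Bochner_Integration.integral_sum)
       (auto intro!: int v s smooth_partial_deriv R'')
  also have "\<dots> = (\<Sum>b\<in>Basis. LINT x|lborel. partial_deriv b (partial_deriv b v) x * \<phi> x)"
    using 1 by (intro sum.cong) auto
  also have "\<dots> = (LINT x|lborel. laplacian v x * \<phi> x)"
    unfolding laplacian_def sum_distrib_right
    by (rule Bochner_Integration.integral_sum[symmetric])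
       (auto intro!: int v s smooth_partial_deriv R)
  finally show ?thesis .
qed

section \<open>Bump functions and the fundamental lemma of the calculus of variations\<close>

text \<open>
  The set where the bound fails is open, and a nonempty open set has positive measure.
\<close>

lemma AE_lborel_continuous_le:
  fixes h :: "'a::euclidean_space \<Rightarrow> real"
  assumes "continuous_on UNIV h" "AE x in lborel. h x \<le> c"
  shows "h x \<le> c"
proof (rule ccontr)
  assume "\<not> h x \<le> c"
  then have ne: "{x. c < h x} \<noteq> {}" by (auto simp: not_le)
  have op: "open {x. c < h x}" by (intro open_Collect_less assms continuous_intros)
  then have "{x. c < h x} \<in> null_sets lborel"
    using assms(2) by (subst AE_iff_null_sets) (auto simp: not_less)
  then have "negligible {x. c < h x}"
    by (simp add: negligible_iff_null_sets null_sets_completionI)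
  then show False using open_not_negligible[OF op ne] by simp
qed

text \<open>
  For \<open>p = 1\<close> this is the classical smooth function \<open>exp (-1/y)\<close> that is flat at the origin. The
  polynomial factor makes the family closed under differentiation: \<open>p\<close> becomes \<open>X\<^sup>2 (p - p')\<close>.
\<close>

definition exp_bump :: "real poly \<Rightarrow> real \<Rightarrow> real" where
  "exp_bump p y = (if 0 < y then poly p (1 / y) * exp (- (1 / y)) else 0)"

lemma poly_times_exp_tendsto_0:
  fixes p :: "real poly"
  shows "((\<lambda>x. poly p x * exp (- x)) \<longlongrightarrow> 0) at_top"
proof -
  have "((\<lambda>x. \<Sum>i\<le>degree p. coeff p i * (x ^ i / exp x)) \<longlongrightarrow> (\<Sum>i\<le>degree p. coeff p i * 0)) at_top"
    by (intro tendsto_sum tendsto_mult tendsto_const tendsto_power_div_exp_0)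
  then show ?thesis
    by (simp add: poly_altdef sum_distrib_right exp_minus divide_inverse mult.assoc)
qed

lemma exp_bump_tendsto_0: "(exp_bump p \<longlongrightarrow> 0) (at 0)"
proof (rule filterlim_split_at)
  have "((\<lambda>y. poly p (inverse y) * exp (- inverse y)) \<longlongrightarrow> 0) (at_right 0)"
    by (rule filterlim_compose[OF poly_times_exp_tendsto_0 filterlim_inverse_at_top_right])
  then show "(exp_bump p \<longlongrightarrow> 0) (at_right 0)"
    by (rule Lim_transform_eventually)
       (auto simp: eventually_at_filter exp_bump_def divide_inverse intro!: always_eventually)
  show "(exp_bump p \<longlongrightarrow> 0) (at_left 0)"
    by (rule Lim_transform_eventually[OF tendsto_const])
       (auto simp: eventually_at_filter exp_bump_def intro!: always_eventually)
qed

lemma exp_bump_has_derivative: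
  "(exp_bump p has_real_derivative exp_bump (monom 1 2 * (p - pderiv p)) y) (at y)"
proof (cases y "0 :: real" rule: linorder_cases)
  case less
  have "((\<lambda>y. 0) has_real_derivative 0) (at y)" by simp
  then have "(exp_bump p has_real_derivative 0) (at y)"
    by (rule has_field_derivative_transform_within_open[where S = "{..<0}"])
       (use less in \<open>auto simp: exp_bump_def\<close>)
  then show ?thesis using less by (simp add: exp_bump_def)
next
  case greater
  have "((\<lambda>y. poly p (1 / y) * exp (- (1 / y))) has_real_derivative
      exp_bump (monom 1 2 * (p - pderiv p)) y) (at y)"
    using greater
    by (auto intro!: derivative_eq_intros DERIV_chain'[where g = "poly p" and f = "\<lambda>y. 1 / y"] poly_DERIV
        simp: exp_bump_def poly_monom power2_eq_square field_simps)
  then show ?thesis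
    by (rule has_field_derivative_transform_within_open[where S = "{0<..}"])
       (use greater in \<open>auto simp: exp_bump_def\<close>)
next
  case equal
  \<comment> \<open>Dividing by the increment multiplies \<open>p\<close> by \<open>X\<close>, so the quotient is again a bump.\<close>
  have "((\<lambda>h. (exp_bump p (0 + h) - exp_bump p 0) / h) \<longlongrightarrow> 0) (at 0)"
    by (rule Lim_transform_eventually[OF exp_bump_tendsto_0[of "monom 1 1 * p"]])
       (auto simp: eventually_at_filter exp_bump_def poly_monom intro!: always_eventually)
  then show ?thesis using equal by (simp add: DERIV_def exp_bump_def)
qed

text \<open>
  The radial bumps around \<open>a\<close> (with \<open>r\<close> the square of the radius of the support) do not form a class
  that is closed under partial derivatives; the algebra that they generate together with the
  coordinate functions does.
\<close>

inductive_set bump_algebra :: "'a::euclidean_space \<Rightarrow> real \<Rightarrow> ('a \<Rightarrow> complex) set" for a r where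
  radial: "(\<lambda>x. of_real (exp_bump p (r - (x - a) \<bullet> (x - a)))) \<in> bump_algebra a r"
| coordinate: "(\<lambda>x. of_real ((x - a) \<bullet> b)) \<in> bump_algebra a r"
| const: "(\<lambda>x. c) \<in> bump_algebra a r"
| add: "f \<in> bump_algebra a r \<Longrightarrow> g \<in> bump_algebra a r \<Longrightarrow> (\<lambda>x. f x + g x) \<in> bump_algebra a r"
| mult: "f \<in> bump_algebra a r \<Longrightarrow> g \<in> bump_algebra a r \<Longrightarrow> (\<lambda>x. f x * g x) \<in> bump_algebra a r"

lemma has_derivative_radial:
  "((\<lambda>x. complex_of_real (exp_bump p (r - (x - a) \<bullet> (x - a)))) has_derivative
    (\<lambda>h. of_real (exp_bump (monom 1 2 * (p - pderiv p)) (r - (x - a) \<bullet> (x - a)) * (- 2 * ((x - a) \<bullet> h))))) (at x)"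
proof -
  have "((\<lambda>x. r - (x - a) \<bullet> (x - a)) has_derivative (\<lambda>h. - 2 * ((x - a) \<bullet> h))) (at x)"
    by (auto intro!: derivative_eq_intros simp: inner_commute)
  from has_derivative_compose[OF this exp_bump_has_derivative[unfolded has_field_derivative_def]]
  show ?thesis by (intro has_derivative_of_real)
qed

lemma has_derivative_coordinate:
  "((\<lambda>x. complex_of_real ((x - a) \<bullet> b)) has_derivative (\<lambda>h. of_real (h \<bullet> b))) (at x)"
  by (auto intro!: derivative_eq_intros has_derivative_of_real)

lemma bump_algebra_differentiable: "f \<in> bump_algebra a r \<Longrightarrow> f differentiable (at x)"
proof (induction rule: bump_algebra.induct)
  case (radial p)
  then show ?case using has_derivative_radial differentiableI by blast
next
  case (coordinate b)
  then show ?case using has_derivative_coordinate differentiableI by blast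
qed auto

lemma bump_algebra_partial_deriv: "f \<in> bump_algebra a r \<Longrightarrow> partial_deriv b f \<in> bump_algebra a r"
proof (induction rule: bump_algebra.induct)
  case (radial p)
  have "partial_deriv b (\<lambda>x. complex_of_real (exp_bump p (r - (x - a) \<bullet> (x - a)))) =
     (\<lambda>x. of_real (exp_bump (monom 1 2 * (p - pderiv p)) (r - (x - a) \<bullet> (x - a)))
        * (- 2 * of_real ((x - a) \<bullet> b)))"
    by (rule ext) (simp add: partial_deriv_eqI[OF has_derivative_radial])
  then show ?case by (auto simp only: intro!: bump_algebra.intros)
next
  case (coordinate c)
  have "partial_deriv b (\<lambda>x. complex_of_real ((x - a) \<bullet> c)) = (\<lambda>x. of_real (b \<bullet> c))"
    by (rule ext) (simp add: partial_deriv_eqI[OF has_derivative_coordinate])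
  then show ?case by (auto intro!: bump_algebra.intros)
next
  case (const c)
  have "partial_deriv b (\<lambda>x. c) = (\<lambda>x. 0)"
    by (rule ext) (simp add: partial_deriv_eqI[OF has_derivative_const])
  then show ?case by (auto intro!: bump_algebra.intros)
next
  case (add f g)
  have "partial_deriv b (\<lambda>x. f x + g x) = (\<lambda>x. partial_deriv b f x + partial_deriv b g x)"
    using add.hyps by (intro ext partial_deriv_add bump_algebra_differentiable)
  then show ?case using add by (auto intro!: bump_algebra.intros)
next
  case (mult f g)
  have "partial_deriv b (\<lambda>x. f x * g x) = (\<lambda>x. f x * partial_deriv b g x + partial_deriv b f x * g x)"
    using mult.hyps by (intro ext partial_deriv_mult bump_algebra_differentiable)
  then show ?case using mult by (auto intro!: bump_algebra.intros)
qed

lemma test_function_bump: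
  "test_function (\<lambda>x. of_real (exp_bump p (r - (x - a) \<bullet> (x - a))))"
proof -
  let ?f = "\<lambda>x. complex_of_real (exp_bump p (r - (x - a) \<bullet> (x - a)))"
  have "smooth ?f"
    by (rule smooth_coinduct[where C = "bump_algebra a r"])
       (auto intro: bump_algebra.radial bump_algebra_differentiable bump_algebra_partial_deriv)
  moreover have "?f x = 0" if "norm a + sqrt \<bar>r\<bar> < norm x" for x
  proof -
    have "sqrt \<bar>r\<bar> < norm (x - a)" using that norm_triangle_ineq2[of x a] by linarith
    then have "(sqrt \<bar>r\<bar>)\<^sup>2 < (norm (x - a))\<^sup>2" by (intro power_strict_mono) auto
    then show ?thesis by (simp add: exp_bump_def power2_norm_eq_inner)
  qed
  ultimately show ?thesis unfolding test_function_iff by blast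
qed

text \<open>
  If \<open>w a \<noteq> 0\<close>, then \<open>cnj (w a) * w\<close> has positive real part near \<open>a\<close>, and a bump supported there gives a
  nonzero integral.
\<close>

lemma fundamental_lemma:
  fixes w :: "'a::euclidean_space \<Rightarrow> complex"
  assumes cont: "continuous_on UNIV w"
    and zero: "\<And>\<phi>. test_function \<phi> \<Longrightarrow> (LINT x|lborel. w x * \<phi> x) = 0"
  shows "w a = 0"
proof (rule ccontr)
  assume a: "w a \<noteq> 0"
  have cont': "continuous_on UNIV (\<lambda>x. Re (cnj (w a) * w x))"
    by (intro continuous_intros cont)
  have "0 < Re (cnj (w a) * w a)"
    using a by (simp add: complex_norm_square[symmetric] mult.commute flip: of_real_power)
  then have "a \<in> {x. 0 < Re (cnj (w a) * w x)}" by simp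
  moreover have "open {x. 0 < Re (cnj (w a) * w x)}" by (intro open_Collect_less cont' continuous_intros)
  ultimately obtain \<rho> where \<rho>: "0 < \<rho>" "ball a \<rho> \<subseteq> {x. 0 < Re (cnj (w a) * w x)}"
    by (meson open_contains_ball)
  define \<phi> :: "'a \<Rightarrow> real" where "\<phi> x = exp_bump 1 (\<rho>\<^sup>2 - (x - a) \<bullet> (x - a))" for x
  have t: "test_function (\<lambda>x. of_real (\<phi> x))"
    unfolding \<phi>_def by (rule test_function_bump)
  have \<phi>: "0 \<le> \<phi> x" "x \<notin> ball a \<rho> \<Longrightarrow> \<phi> x = 0" for x
  proof -
    show "0 \<le> \<phi> x" by (simp add: \<phi>_def exp_bump_def)
    show "\<phi> x = 0" if "x \<notin> ball a \<rho>"
    proof -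
      have "\<rho>\<^sup>2 \<le> (norm (x - a))\<^sup>2" using that \<rho> by (intro power_mono) (auto simp: dist_norm norm_minus_commute)
      then show ?thesis by (simp add: \<phi>_def exp_bump_def power2_norm_eq_inner)
    qed
  qed
  define k where "k x = Re (cnj (w a) * w x) * \<phi> x" for x
  have tc: "continuous_on UNIV (\<lambda>x. complex_of_real (\<phi> x))"
    using t by (auto simp only: test_function_iff intro: smooth_imp_continuous_on)
  have \<phi>c: "continuous_on UNIV \<phi>"
    using continuous_on_Re[OF tc] by (simp only: Re_complex_of_real)
  have k: "0 \<le> k x" for x
    using \<phi>[of x] \<rho> by (cases "x \<in> ball a \<rho>") (auto simp: k_def intro!: mult_nonneg_nonneg dest!: subsetD)
  have int: "integrable lborel (\<lambda>x. w x * of_real (\<phi> x))"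
  proof (rule integrable_compact_support[where R = "norm a + \<rho>"])
    show "continuous_on UNIV (\<lambda>x. w x * of_real (\<phi> x))" by (intro continuous_intros cont \<phi>c)
    fix x :: 'a assume "norm a + \<rho> < norm x"
    then have "x \<notin> ball a \<rho>" using norm_triangle_ineq2[of x a] by (auto simp: dist_norm norm_minus_commute)
    then show "w x * of_real (\<phi> x) = 0" using \<phi> by simp
  qed
  have k_eq: "k x = Re (cnj (w a) * (w x * of_real (\<phi> x)))" for x
    by (simp add: k_def algebra_simps)
  have "integrable lborel k"
    unfolding k_eq by (intro integrable_Re integrable_mult_right int)
  moreover have "(LINT x|lborel. k x) = 0"
    unfolding k_eq using int zero[OF t] by (subst integral_Re) (auto intro!: integrable_mult_right)
  ultimately have "AE x in lborel. k x = 0"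
    using integral_nonneg_eq_0_iff_AE[of lborel k] k by auto
  then have "AE x in lborel. k x \<le> 0" by eventually_elim simp
  then have "k a \<le> 0"
    by (rule AE_lborel_continuous_le[rotated]) (auto simp: k_def[abs_def] intro!: continuous_intros cont \<phi>c)
  moreover have "0 < k a"
    using \<rho> by (auto simp: k_def \<phi>_def exp_bump_def intro!: mult_pos_pos dest!: subsetD)
  ultimately show False by simp
qed

lemma smooth_cis: "smooth (\<lambda>x. c * cis (- (x \<bullet> \<xi>)))"
  and partial_deriv_cis: "partial_deriv b (\<lambda>x. c * cis (- (x \<bullet> \<xi>))) = (\<lambda>x. - (\<i> * of_real (b \<bullet> \<xi>) * c) * cis (- (x \<bullet> \<xi>)))"
proof -
  have d: "((\<lambda>x. c * cis (- (x \<bullet> \<xi>))) has_derivative (\<lambda>h. - (\<i> * of_real (h \<bullet> \<xi>) * c) * cis (- (x \<bullet> \<xi>)))) (at x)" for c x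
    by (auto intro!: derivative_eq_intros simp: scaleR_conv_of_real mult_ac)
  show pd: "partial_deriv b (\<lambda>x. c * cis (- (x \<bullet> \<xi>))) = (\<lambda>x. - (\<i> * of_real (b \<bullet> \<xi>) * c) * cis (- (x \<bullet> \<xi>)))" for b c
    by (rule ext) (simp add: partial_deriv_eqI[OF d])
  show "smooth (\<lambda>x. c * cis (- (x \<bullet> \<xi>)))"
    by (rule smooth_coinduct[where C = "{\<lambda>x. c * cis (- (x \<bullet> \<xi>)) | c. True}"])
       (use d in \<open>auto simp only: pd intro: differentiableI\<close>)
qed

lemma laplacian_cis: "laplacian (\<lambda>x. cis (- (x \<bullet> \<xi>))) x = - of_real ((norm \<xi>)\<^sup>2) * cis (- (x \<bullet> \<xi>))"
proof -
  have "laplacian (\<lambda>x. 1 * cis (- (x \<bullet> \<xi>))) x = (\<Sum>b\<in>Basis. - of_real ((\<xi> \<bullet> b) * (\<xi> \<bullet> b)) * cis (- (x \<bullet> \<xi>)))"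
    unfolding laplacian_def partial_deriv_cis by (intro sum.cong) (auto simp: inner_commute algebra_simps)
  also have "\<dots> = - of_real (\<Sum>b\<in>Basis. (\<xi> \<bullet> b) * (\<xi> \<bullet> b)) * cis (- (x \<bullet> \<xi>))"
    by (simp add: sum_distrib_right sum_negf)
  finally show ?thesis by (simp add: euclidean_inner[symmetric] power2_norm_eq_inner)
qed

text \<open>
  Green's identity against a plane wave, which is an eigenfunction of the Laplacian.
\<close>

lemma fourier_neg_laplacian:
  assumes "test_function \<phi>"
  shows "fourier (\<lambda>x. - laplacian \<phi> x) \<xi> = of_real ((norm \<xi>)\<^sup>2) * fourier \<phi> \<xi>"
proof -
  have "(LINT x|lborel. cis (- (x \<bullet> \<xi>)) * laplacian \<phi> x)
      = (LINT x|lborel. - of_real ((norm \<xi>)\<^sup>2) * (\<phi> x * cis (- (x \<bullet> \<xi>))))"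
    using green_identity[OF smooth_cis[of 1 \<xi>] assms] by (simp add: laplacian_cis mult_ac)
  also have "\<dots> = - of_real ((norm \<xi>)\<^sup>2) * fourier \<phi> \<xi>"
    unfolding fourier_def by (rule integral_mult_right_zero)
  finally have "(LINT x|lborel. laplacian \<phi> x * cis (- (x \<bullet> \<xi>))) = - of_real ((norm \<xi>)\<^sup>2) * fourier \<phi> \<xi>"
    by (simp add: mult.commute)
  then show ?thesis by (simp add: fourier_def)
qed

section \<open>Gaussian integrals and interchange of integrals\<close>

lemma borel_measurable_cis [measurable]: "cis \<in> borel_measurable borel"
  by (intro borel_measurable_continuous_onI continuous_intros)

lemma sum_Basis_inner_square: "(\<Sum>b\<in>Basis. (x \<bullet> b)\<^sup>2) = (norm x)\<^sup>2"
  by (subst power2_norm_eq_inner, subst euclidean_inner) (simp add: power2_eq_square)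

lemma
  fixes f :: "'a::euclidean_space \<Rightarrow> real \<Rightarrow> complex"
  assumes "\<And>b. b \<in> Basis \<Longrightarrow> integrable lborel (f b)"
  shows integrable_lborel_prod: "integrable lborel (\<lambda>x::'a. \<Prod>b\<in>Basis. f b (x \<bullet> b))"
    and integral_lborel_prod:
      "(LINT x::'a|lborel. (\<Prod>b\<in>Basis. f b (x \<bullet> b))) = (\<Prod>b\<in>Basis. LINT y|lborel. f b y)"
proof -
  interpret product_sigma_finite "\<lambda>_::'a. lborel :: real measure" ..
  have [measurable]: "\<And>b. b \<in> Basis \<Longrightarrow> f b \<in> borel_measurable borel" using assms by auto
  have m: "(\<lambda>x::'a. \<Prod>b\<in>Basis. f b (x \<bullet> b)) \<in> borel_measurable borel"
    by (rule borel_measurable_prod) measurable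
  have eq: "(\<Prod>b\<in>Basis. f b ((\<Sum>b\<in>Basis. g b *\<^sub>R b) \<bullet> b)) = (\<Prod>b\<in>Basis. f b (g b))" for g :: "'a \<Rightarrow> real"
    by (intro prod.cong) auto
  have s: "(\<lambda>f. \<Sum>b\<in>Basis. f b *\<^sub>R b) \<in> measurable (\<Pi>\<^sub>M b\<in>(Basis :: 'a set). lborel :: real measure) borel"
    by measurable
  show "integrable lborel (\<lambda>x::'a. \<Prod>b\<in>Basis. f b (x \<bullet> b))"
    by (subst lborel_eq, subst integrable_distr_eq[OF s m])
       (simp only: eq, intro product_integrable_prod assms finite_Basis)
  show "(LINT x::'a|lborel. (\<Prod>b\<in>Basis. f b (x \<bullet> b))) = (\<Prod>b\<in>Basis. LINT y|lborel. f b y)"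
    by (subst lborel_eq, subst integral_distr[OF s m])
       (simp only: eq, intro product_integral_prod assms finite_Basis)
qed

text \<open>
  As \<open>|x \<bullet> b| \<le> |x|\<close> for each basis vector, the weight is dominated by a product of one-dimensional
  functions \<open>1 / (1 + y\<^sup>2)\<close>.
\<close>

lemma integrable_bessel_weight:
  "integrable lborel (\<lambda>x::'a::euclidean_space. inverse ((1 + (norm x)\<^sup>2) ^ DIM('a)))"
proof -
  have i1: "integrable lborel (\<lambda>y::real. complex_of_real (inverse (1 + y\<^sup>2)))"
    using integrable_inverse_1_plus_square
    by (intro integrable_of_real) (simp add: set_integrable_def einterval_def)
  have "integrable lborel (\<lambda>x::'a. \<Prod>b\<in>Basis. complex_of_real (inverse (1 + (x \<bullet> b)\<^sup>2)))"
    using i1 by (rule integrable_lborel_prod)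
  then have "integrable lborel (\<lambda>x::'a. norm (\<Prod>b\<in>Basis. complex_of_real (inverse (1 + (x \<bullet> b)\<^sup>2))))"
    by (rule integrable_norm)
  then have "integrable lborel (\<lambda>x::'a. (\<Prod>b\<in>Basis. inverse (1 + (x \<bullet> b)\<^sup>2)))"
    by (simp add: prod_norm[symmetric] norm_inverse add_nonneg_nonneg flip: of_real_add of_real_power)
  then show ?thesis
  proof (rule Bochner_Integration.integrable_bound)
    show "AE x::'a in lborel. norm (inverse ((1 + (norm x)\<^sup>2) ^ DIM('a)))
        \<le> norm (\<Prod>b\<in>Basis. inverse (1 + (x \<bullet> b)\<^sup>2))"
    proof (rule AE_I2)
      fix x :: 'a
      have p: "0 < (\<Prod>b\<in>Basis. 1 + (x \<bullet> b)\<^sup>2)" by (intro prod_pos) (simp add: add_pos_nonneg)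
      have "(\<Prod>b\<in>Basis. 1 + (x \<bullet> b)\<^sup>2) \<le> (\<Prod>b\<in>(Basis :: 'a set). 1 + (norm x)\<^sup>2)"
      proof (rule prod_mono, intro conjI add_left_mono)
        fix b :: 'a assume "b \<in> Basis"
        then have "\<bar>x \<bullet> b\<bar> \<le> norm x" by (rule Basis_le_norm)
        then show "(x \<bullet> b)\<^sup>2 \<le> (norm x)\<^sup>2" using abs_le_square_iff[of "x \<bullet> b" "norm x"] by simp
      qed simp
      then have "inverse ((1 + (norm x)\<^sup>2) ^ DIM('a)) \<le> inverse (\<Prod>b\<in>Basis. 1 + (x \<bullet> b)\<^sup>2)"
        using p by (simp add: le_imp_inverse_le)
      also have "\<dots> = (\<Prod>b\<in>Basis. inverse (1 + (x \<bullet> b)\<^sup>2))" by (rule prod_inversef[unfolded o_def, symmetric])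
      finally show "norm (inverse ((1 + (norm x)\<^sup>2) ^ DIM('a)))
        \<le> norm (\<Prod>b\<in>Basis. inverse (1 + (x \<bullet> b)\<^sup>2))" by simp
    qed
  qed measurable
qed

definition gauss :: "'a::euclidean_space \<Rightarrow> real" where
  "gauss z = (\<Prod>b\<in>Basis. std_normal_density (z \<bullet> b))"

lemma gauss_nonneg [simp]: "0 \<le> gauss z"
  by (simp add: gauss_def prod_nonneg)

lemma continuous_on_gauss [continuous_intros]:
  "continuous_on A f \<Longrightarrow> continuous_on A (\<lambda>x. gauss (f x))"
  unfolding gauss_def std_normal_density_def by (intro continuous_intros) auto

lemma borel_measurable_gauss [measurable]: "gauss \<in> borel_measurable borel"
  by (intro borel_measurable_continuous_onI continuous_intros)

lemma gauss_eq: "gauss z = exp (- (norm z)\<^sup>2 / 2) / sqrt (2 * pi) ^ DIM('a)" for z :: "'a::euclidean_space"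
proof -
  have "gauss z = (\<Prod>b\<in>Basis. exp (- (z \<bullet> b)\<^sup>2 / 2) / sqrt (2 * pi))"
    by (simp add: gauss_def std_normal_density_def)
  also have "\<dots> = exp (\<Sum>b\<in>Basis. - (z \<bullet> b)\<^sup>2 / 2) / sqrt (2 * pi) ^ DIM('a)"
    by (simp add: prod_dividef exp_sum)
  also have "(\<Sum>b\<in>Basis. - (z \<bullet> b)\<^sup>2 / 2) = - (norm z)\<^sup>2 / 2"
    by (simp add: sum_Basis_inner_square sum_negf flip: sum_divide_distrib)
  finally show ?thesis .
qed

text \<open>
  The Gaussian factorises over the coordinates, and each factor is the characteristic function of
  the one-dimensional normal distribution.
\<close>

lemma
  shows integrable_gauss_cis: "integrable lborel (\<lambda>z::'a::euclidean_space. gauss z * cis (z \<bullet> \<xi>))"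
    and integral_gauss_cis:
      "(LINT z|lborel. gauss z * cis (z \<bullet> \<xi>)) = of_real (exp (- (norm (\<xi>::'a))\<^sup>2 / 2))"
proof -
  let ?f = "\<lambda>b::'a. \<lambda>y::real. complex_of_real (std_normal_density y) * cis (y * (\<xi> \<bullet> b))"
  have int: "integrable lborel (?f b)" for b
    by (rule Bochner_Integration.integrable_bound[OF integrable_normal_density[of 1 0]])
       (auto simp: norm_mult)
  have val: "(LINT y|lborel. ?f b y) = of_real (exp (- (\<xi> \<bullet> b)\<^sup>2 / 2))" for b
  proof -
    have "char std_normal_distribution (\<xi> \<bullet> b) = (LINT y|lborel. std_normal_density y *\<^sub>R cis ((\<xi> \<bullet> b) * y))"
      unfolding char_def by (subst integral_density) (auto simp: cis_conv_exp)
    then show ?thesis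
      by (simp add: char_std_normal_distribution scaleR_conv_of_real mult.commute)
  qed
  have eq: "(\<Prod>b\<in>Basis. ?f b (z \<bullet> b)) = gauss z * cis (z \<bullet> \<xi>)" for z
    unfolding prod.distrib of_real_prod gauss_def
    by (subst euclidean_inner) (simp add: cis_conv_exp exp_sum sum_distrib_left)
  show "integrable lborel (\<lambda>z::'a. gauss z * cis (z \<bullet> \<xi>))"
    using integrable_lborel_prod[of ?f, OF int] by (simp add: eq)
  have "(LINT z|lborel. gauss z * cis (z \<bullet> \<xi>)) = (\<Prod>b\<in>Basis. of_real (exp (- (\<xi> \<bullet> b)\<^sup>2 / 2)))"
    using integral_lborel_prod[of ?f, OF int] by (simp add: eq val)
  also have "\<dots> = complex_of_real (exp (\<Sum>b\<in>Basis. - (\<xi> \<bullet> b)\<^sup>2 / 2))"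
    by (simp add: exp_sum)
  also have "(\<Sum>b\<in>Basis. - (\<xi> \<bullet> b)\<^sup>2 / 2) = - (norm \<xi>)\<^sup>2 / 2"
    by (simp add: sum_Basis_inner_square sum_negf flip: sum_divide_distrib)
  finally show "(LINT z|lborel. gauss z * cis (z \<bullet> \<xi>)) = of_real (exp (- (norm \<xi>)\<^sup>2 / 2))" .
qed

lemma integrable_gauss: "integrable lborel (gauss :: 'a::euclidean_space \<Rightarrow> real)"
  using integrable_Re[OF integrable_gauss_cis[of "0::'a"]] by simp

lemma integral_gauss: "(LINT z::'a::euclidean_space|lborel. gauss z) = 1"
proof -
  have "complex_of_real (LINT z::'a|lborel. gauss z) = of_real 1"
    using integral_gauss_cis[of "0::'a"] by simp
  then show ?thesis by (simp only: of_real_eq_iff)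
qed

text \<open>
  The form of Fubini's theorem for superpositions \<open>\<integral> f(\<cdot>, y) dy\<close> of integrable functions: if their
  \<open>L\<^sup>1\<close> norms are dominated by an integrable function of the parameter, then the superposition is
  integrable, with the expected bound of its norm, and it may be integrated term by term.
\<close>

lemma
  fixes f :: "'a::euclidean_space \<Rightarrow> 'b::euclidean_space \<Rightarrow> complex"
  assumes meas [measurable]: "(\<lambda>(x, y). f x y) \<in> borel_measurable (borel \<Otimes>\<^sub>M borel)"
    and int: "\<And>y. integrable lborel (\<lambda>x. f x y)"
    and bound: "\<And>y. (LINT x|lborel. norm (f x y)) \<le> B y"
    and B: "integrable lborel B"
  shows fubini_integrable: "integrable lborel (\<lambda>x. LINT y|lborel. f x y)"
    and fubini_swap: "(LINT x|lborel. LINT y|lborel. f x y) = (LINT y|lborel. LINT x|lborel. f x y)"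
    and fubini_norm: "(LINT x|lborel. norm (LINT y|lborel. f x y)) \<le> (LINT y|lborel. B y)"
proof -
  have m1: "(\<lambda>(x, y). f x y) \<in> borel_measurable (lborel \<Otimes>\<^sub>M lborel)" by measurable
  have m2: "(\<lambda>(y, x). f x y) \<in> borel_measurable (lborel \<Otimes>\<^sub>M lborel)" by measurable
  have iN: "integrable lborel (\<lambda>y. LINT x|lborel. norm (f x y))"
  proof (rule Bochner_Integration.integrable_bound[OF B])
    show "(\<lambda>y. LINT x|lborel. norm (f x y)) \<in> borel_measurable lborel" by measurable
    show "AE y in lborel. norm (LINT x|lborel. norm (f x y)) \<le> norm (B y)"
      by (rule AE_I2) (use bound in \<open>simp add: order_trans[OF _ abs_ge_self]\<close>)
  qed
  have q: "integrable (lborel \<Otimes>\<^sub>M lborel) (\<lambda>(y, x). f x y)"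
    by (rule lborel_pair.Fubini_integrable[OF m2]) (use iN int in auto)
  then have p: "integrable (lborel \<Otimes>\<^sub>M lborel) (\<lambda>(x, y). f x y)"
    using lborel_pair.integrable_product_swap_iff[of "\<lambda>(y, x). f x y"] by simp
  show "integrable lborel (\<lambda>x. LINT y|lborel. f x y)" by (rule lborel_pair.integrable_fst[OF p])
  show "(LINT x|lborel. LINT y|lborel. f x y) = (LINT y|lborel. LINT x|lborel. f x y)"
    using lborel_pair.integral_fst[OF p] lborel_pair.integral_snd[OF p] by simp
  have pn: "integrable (lborel \<Otimes>\<^sub>M lborel) (\<lambda>(x, y). norm (f x y))"
    using integrable_norm[OF p] by (simp add: case_prod_unfold)
  have "(LINT x|lborel. norm (LINT y|lborel. f x y)) \<le> (LINT x|lborel. LINT y|lborel. norm (f x y))"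
    by (intro integral_mono integrable_norm lborel_pair.integrable_fst[OF p] lborel_pair.integrable_fst[OF pn] integral_norm_bound)
  also have "\<dots> = (LINT y|lborel. LINT x|lborel. norm (f x y))"
    using lborel_pair.integral_fst[OF pn] lborel_pair.integral_snd[OF pn] by simp
  also have "\<dots> \<le> (LINT y|lborel. B y)"
    by (intro integral_mono iN B bound)
  finally show "(LINT x|lborel. norm (LINT y|lborel. f x y)) \<le> (LINT y|lborel. B y)" .
qed

section \<open>Fractional powers as mixtures of exponentials\<close>

text \<open>
  Up to a constant factor this is the density of the Levy measure of the \<open>s\<close>-stable subordinator. It
  expresses a fractional power as a mixture of exponentials, and thereby \<open>(-\<Delta>)\<^sup>s\<close> by the heat flow.
\<close>

definition levy_kernel :: "real \<Rightarrow> real \<Rightarrow> real" where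
  "levy_kernel s r = indicator {0<..} r * r powr (- 1 - s)"

lemma levy_kernel_nonneg [simp]: "0 \<le> levy_kernel s r"
  by (simp add: levy_kernel_def)

lemma borel_measurable_levy_kernel [measurable]: "levy_kernel s \<in> borel_measurable borel"
  unfolding levy_kernel_def[abs_def] by measurable

lemma integrable_min_levy_kernel:
  assumes s: "0 < s" "s < 1"
  shows "integrable lborel (\<lambda>r. min 1 r * levy_kernel s r)"
proof -
  have "set_integrable lebesgue {0..1} (\<lambda>r::real. r powr (- s))"
    by (rule nonnegative_absolutely_integrable_1[OF integrable_on_powr_from_0]) (use s in auto)
  then have 1: "integrable lborel (\<lambda>r::real. indicator {0..1} r *\<^sub>R r powr (- s))"
    unfolding set_integrable_def by (subst (asm) integrable_completion) auto
  have "set_integrable lebesgue {1..} (\<lambda>r::real. r powr (- 1 - s))"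
    by (rule nonnegative_absolutely_integrable_1)
       (use has_integral_powr_to_inf[of "- 1 - s" 1] s in \<open>auto simp: integrable_on_def\<close>)
  then have 2: "integrable lborel (\<lambda>r::real. indicator {1..} r *\<^sub>R r powr (- 1 - s))"
    unfolding set_integrable_def by (subst (asm) integrable_completion) auto
  show ?thesis
  proof (rule Bochner_Integration.integrable_bound[OF Bochner_Integration.integrable_add[OF 1 2]])
    show "AE r in lborel. norm (min 1 r * levy_kernel s r)
        \<le> norm (indicator {0..1} r *\<^sub>R r powr (- s) + indicator {1..} r *\<^sub>R r powr (- 1 - s))"
    proof (rule AE_I2)
      fix r :: real
      consider "r \<le> 0" | "0 < r" "r \<le> 1" | "1 < r" by linarith
      then show "norm (min 1 r * levy_kernel s r)
        \<le> norm (indicator {0..1} r *\<^sub>R r powr (- s) + indicator {1..} r *\<^sub>R r powr (- 1 - s))"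
      proof cases
        case 2
        have "min 1 r * levy_kernel s r = r * r powr (- 1 - s)"
          using 2 by (simp add: levy_kernel_def)
        also have "\<dots> = r powr (1 + (- 1 - s))" by (rule powr_mult_base) (use 2 in simp)
        also have "\<dots> = r powr (- s)" by simp
        finally have e: "min 1 r * levy_kernel s r = r powr (- s)" .
        show ?thesis unfolding e using 2 by (simp add: indicator_def)
      qed (auto simp: levy_kernel_def)
    qed
  qed measurable
qed

lemma one_minus_exp_le_min: "0 \<le> (x::real) \<Longrightarrow> 1 - exp (- x) \<le> min 1 x"
  using exp_ge_add_one_self[of "- x"] by simp

lemma min_1_mult_le:
  assumes "0 \<le> (r::real)" "0 \<le> l"
  shows "min 1 (r * l) \<le> min 1 r * (1 + l)"
proof (cases "r \<le> 1")
  case True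
  then show ?thesis using assms by (simp add: algebra_simps min_le_iff_disj)
next
  case False
  then show ?thesis using assms by simp
qed

definition levy_constant :: "real \<Rightarrow> real" where
  "levy_constant s = (LINT r|lborel. (1 - exp (- r)) * levy_kernel s r)"

lemma integrable_bounded_levy_kernel:
  fixes f :: "real \<Rightarrow> 'b::{banach, second_countable_topology}"
  assumes s: "0 < s" "s < 1" and [measurable]: "f \<in> borel_measurable borel"
    and f: "\<And>r. 0 < r \<Longrightarrow> norm (f r) \<le> M * min 1 r"
  shows "integrable lborel (\<lambda>r. levy_kernel s r *\<^sub>R f r)"
    and "norm (LINT r|lborel. levy_kernel s r *\<^sub>R f r) \<le> M * (LINT r|lborel. min 1 r * levy_kernel s r)"
proof -
  have b: "norm (levy_kernel s r *\<^sub>R f r) \<le> M * (min 1 r * levy_kernel s r)" for r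
    using mult_right_mono[OF f, of r "levy_kernel s r"]
    by (cases "0 < r") (auto simp: mult_ac levy_kernel_def)
  note i = integrable_mult_right[OF integrable_min_levy_kernel[OF s], of M]
  show "integrable lborel (\<lambda>r. levy_kernel s r *\<^sub>R f r)"
    by (rule Bochner_Integration.integrable_bound[OF i])
       (use b in \<open>auto intro!: AE_I2 intro: order_trans[OF _ abs_ge_self]\<close>)
  then have "norm (LINT r|lborel. levy_kernel s r *\<^sub>R f r) \<le> (LINT r|lborel. M * (min 1 r * levy_kernel s r))"
    by (intro integral_norm_bound[THEN order_trans] integral_mono i b integrable_norm)
  then show "norm (LINT r|lborel. levy_kernel s r *\<^sub>R f r) \<le> M * (LINT r|lborel. min 1 r * levy_kernel s r)"
    by simp
qed

lemma integrable_exp_levy_kernel: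
  assumes s: "0 < s" "s < 1" and l: "0 \<le> l"
  shows "integrable lborel (\<lambda>r. (1 - exp (- (r * l))) * levy_kernel s r)"
proof -
  have "integrable lborel (\<lambda>r. levy_kernel s r *\<^sub>R (1 - exp (- (r * l))))"
  proof (rule integrable_bounded_levy_kernel[OF s])
    fix r :: real assume r: "0 < r"
    have "1 - exp (- (r * l)) \<le> min 1 r * (1 + l)"
      by (rule order_trans[OF one_minus_exp_le_min min_1_mult_le]) (use r l in auto)
    then show "norm (1 - exp (- (r * l))) \<le> (1 + l) * min 1 r" using r l by (simp add: mult.commute)
  qed measurable
  then show ?thesis by (simp add: mult.commute)
qed

lemma levy_constant_pos:
  assumes s: "0 < s" "s < 1"
  shows "0 < levy_constant s"
proof -
  have i: "integrable lborel (\<lambda>r. (1 - exp (- r)) * levy_kernel s r)"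
    using integrable_exp_levy_kernel[OF s, of 1] by simp
  have nn: "0 \<le> (1 - exp (- r)) * levy_kernel s r" for r
    by (cases "0 < r") (auto simp: levy_kernel_def)
  have "levy_constant s \<noteq> 0"
  proof
    assume "levy_constant s = 0"
    then have "AE r in lborel. (1 - exp (- r)) * levy_kernel s r = 0"
      using integral_nonneg_eq_0_iff_AE[OF i] nn unfolding levy_constant_def by blast
    then have "AE r in lborel. r \<notin> {0<..<1::real}"
      by eventually_elim (auto simp: levy_kernel_def)
    then have "emeasure lborel {0<..<1::real} = 0"
      by (subst (asm) AE_iff_measurable[of "{0<..<1}"]) auto
    then show False by simp
  qed
  moreover have "0 \<le> levy_constant s" unfolding levy_constant_def by (intro integral_nonneg_AE AE_I2 nn)
  ultimately show ?thesis by simp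
qed

text \<open>
  Substituting \<open>l r\<close> for \<open>r\<close> in the integral that defines the constant produces the factor \<open>l\<^sup>s\<close>.
\<close>

lemma levy_representation:
  assumes s: "0 < s" "s < 1" and l: "0 \<le> l"
  shows "(LINT r|lborel. (1 - exp (- (r * l))) * levy_kernel s r) = levy_constant s * l powr s"
proof (cases "l = 0")
  case False
  with l have l: "0 < l" by simp
  have eq: "(1 - exp (- (l * r))) * levy_kernel s (l * r) / l powr (- 1 - s) = (1 - exp (- (r * l))) * levy_kernel s r" for r
    using l by (auto simp: levy_kernel_def indicator_def powr_mult zero_less_mult_iff mult.commute)
  have "levy_constant s = \<bar>l\<bar> *\<^sub>R (LINT r|lborel. (1 - exp (- (0 + l * r))) * levy_kernel s (0 + l * r))"
    unfolding levy_constant_def by (rule lborel_integral_real_affine) (use l in auto)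
  also have "(LINT r|lborel. (1 - exp (- (0 + l * r))) * levy_kernel s (0 + l * r))
      = (LINT r|lborel. l powr (- 1 - s) * ((1 - exp (- (r * l))) * levy_kernel s r))"
    using l by (intro Bochner_Integration.integral_cong) (auto simp: eq[symmetric])
  also have "\<dots> = l powr (- 1 - s) * (LINT r|lborel. (1 - exp (- (r * l))) * levy_kernel s r)"
    by simp
  finally have "levy_constant s * l powr s
      = (l powr 1 * l powr (- 1 - s) * l powr s) * (LINT r|lborel. (1 - exp (- (r * l))) * levy_kernel s r)"
    using l by (simp add: mult_ac)
  then show ?thesis using l by (simp add: powr_add[symmetric])
qed simp

lemma integral_exp_Icc:
  assumes "0 \<le> r"
  shows "(LINT \<tau>|lborel. indicator {0..r} \<tau> * (l * exp (- (\<tau> * l)))) = 1 - exp (- (r * (l::real)))"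
proof -
  have "(LINT \<tau>|lborel. indicator {0..r} \<tau> *\<^sub>R (l * exp (- (\<tau> * l)))) = - exp (- (r * l)) - (- exp (- (0 * l)))"
    by (rule integral_FTC_Icc[OF assms])
       (auto intro!: derivative_eq_intros continuous_intros
         simp: has_real_derivative_iff_has_vector_derivative[symmetric])
  then show ?thesis by simp
qed

section \<open>Radial multipliers and the heat flow\<close>

text \<open>
  All operators are functions of \<open>-\<Delta>\<close>, hence they are given by functions \<open>h\<close> of \<open>l = |\<xi>|\<^sup>2\<close>. On this
  side they commute and compose by pointwise multiplication.
\<close>

definition multiplier :: "(real \<Rightarrow> real) \<Rightarrow> ('a::euclidean_space \<Rightarrow> complex) \<Rightarrow> 'a \<Rightarrow> complex" where
  "multiplier h g \<xi> = of_real (h ((norm \<xi>)\<^sup>2)) * g \<xi>"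

lemma multiplier_multiplier: "multiplier h (multiplier k g) = multiplier (\<lambda>l. h l * k l) g"
  by (simp add: multiplier_def fun_eq_iff mult.assoc)

lemma norm_multiplier: "norm (multiplier h g \<xi>) = \<bar>h ((norm \<xi>)\<^sup>2)\<bar> * norm (g \<xi>)"
  by (simp only: multiplier_def norm_mult norm_of_real)

lemma multiplier_cong: "(\<And>l. 0 \<le> l \<Longrightarrow> h l = k l) \<Longrightarrow> multiplier h g = multiplier k g"
  by (simp add: multiplier_def fun_eq_iff)

lemma multiplier_measurable [measurable]:
  assumes [measurable]: "h \<in> borel_measurable borel" "g \<in> borel_measurable borel"
  shows "multiplier h g \<in> borel_measurable borel"
  unfolding multiplier_def[abs_def] by measurable

lemma integrable_multiplier:
  assumes g: "integrable lborel g" and [measurable]: "h \<in> borel_measurable borel"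
    and h: "\<And>l. 0 \<le> l \<Longrightarrow> \<bar>h l\<bar> \<le> M"
  shows "integrable lborel (multiplier h g)"
proof (rule Bochner_Integration.integrable_bound[OF integrable_mult_right[OF g, of "of_real M"]])
  have [measurable]: "g \<in> borel_measurable borel" using g by auto
  show "multiplier h g \<in> borel_measurable lborel" by measurable
  have M: "0 \<le> M" using h[of 0] by simp
  show "AE \<xi> in lborel. norm (multiplier h g \<xi>) \<le> norm (of_real M * g \<xi>)"
    by (rule AE_I2) (use h M in \<open>auto simp: multiplier_def norm_mult intro!: mult_right_mono\<close>)
qed

lemma integrable_times_cis: "integrable lborel g \<Longrightarrow> integrable lborel (\<lambda>\<xi>. g \<xi> * cis (x \<bullet> \<xi>))"
  by (rule Bochner_Integration.integrable_bound) (auto simp: norm_mult)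

lemma inverse_fourier_measurable [measurable]:
  assumes [measurable]: "g \<in> borel_measurable borel"
  shows "inverse_fourier g \<in> borel_measurable borel"
  unfolding inverse_fourier_def[abs_def] by measurable

lemma inverse_fourier_measurable_parameter:
  fixes h :: "'b::euclidean_space \<Rightarrow> 'a::euclidean_space \<Rightarrow> complex"
  assumes [measurable]: "(\<lambda>(y, \<xi>). h y \<xi>) \<in> borel_measurable (borel \<Otimes>\<^sub>M borel)"
  shows "(\<lambda>(x, y). inverse_fourier (h y) x) \<in> borel_measurable (borel \<Otimes>\<^sub>M borel)"
  unfolding inverse_fourier_def[abs_def] by measurable

lemma inverse_fourier_diff:
  assumes "integrable lborel f" "integrable lborel g"
  shows "inverse_fourier (\<lambda>\<xi>. f \<xi> - g \<xi>) x = inverse_fourier f x - inverse_fourier g x"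
  using assms unfolding inverse_fourier_def left_diff_distrib
  by (subst Bochner_Integration.integral_diff) (auto intro: integrable_times_cis simp: diff_divide_distrib)

lemma inverse_fourier_translate:
  "inverse_fourier (\<lambda>\<xi>. g \<xi> * cis (- (a \<bullet> \<xi>))) x = inverse_fourier g (x - a)"
  unfolding inverse_fourier_def by (simp add: mult.assoc cis_mult inner_diff_left algebra_simps)

text \<open>
  The multiplier \<open>exp (-t |\<xi>|\<^sup>2)\<close> is the characteristic function of a centred Gaussian vector of
  variance \<open>2 t\<close> per coordinate, so the heat flow averages translates of the function. Placing the
  factor \<open>sqrt (2 t)\<close> in the argument, and not in the density, includes the case \<open>t = 0\<close>.
\<close>

lemma inverse_fourier_heat:
  fixes g :: "'a::euclidean_space \<Rightarrow> complex"
  assumes g: "integrable lborel g" and t: "0 \<le> t"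
  shows "inverse_fourier (multiplier (\<lambda>l. exp (- (t * l))) g) x
    = (LINT z|lborel. of_real (gauss z) * inverse_fourier g (x - sqrt (2 * t) *\<^sub>R z))"
proof -
  have [measurable]: "g \<in> borel_measurable borel" using g by auto
  let ?c = "of_real ((2 * pi) ^ DIM('a)) :: complex"
  let ?f = "\<lambda>z \<xi>. of_real (gauss z) * (g \<xi> * cis ((x - sqrt (2 * t) *\<^sub>R z) \<bullet> \<xi>))"
  have split: "?f z \<xi> = g \<xi> * cis (x \<bullet> \<xi>) * (of_real (gauss z) * cis (z \<bullet> (- sqrt (2 * t) *\<^sub>R \<xi>)))" for z \<xi>
    by (simp add: inner_diff_left mult_ac flip: cis_mult) (simp add: cis_mult algebra_simps)
  have swap: "(LINT z|lborel. LINT \<xi>|lborel. ?f z \<xi>) = (LINT \<xi>|lborel. LINT z|lborel. ?f z \<xi>)"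
  proof (rule fubini_swap[where B = "\<lambda>\<xi>. norm (g \<xi>)"])
    show "(\<lambda>(z, \<xi>). ?f z \<xi>) \<in> borel_measurable (borel \<Otimes>\<^sub>M borel)" by measurable
    show "integrable lborel (\<lambda>z. ?f z \<xi>)" for \<xi>
      unfolding split by (intro integrable_mult_right integrable_gauss_cis)
    show "(LINT z|lborel. norm (?f z \<xi>)) \<le> norm (g \<xi>)" for \<xi>
      by (simp add: norm_mult integral_gauss)
    show "integrable lborel (\<lambda>\<xi>. norm (g \<xi>))" using g by (rule integrable_norm)
  qed
  have in1: "(LINT \<xi>|lborel. ?f z \<xi>) = of_real (gauss z) * inverse_fourier g (x - sqrt (2 * t) *\<^sub>R z) * ?c" for z
    by (simp add: inverse_fourier_def)
  have in2: "(LINT z|lborel. ?f z \<xi>) = multiplier (\<lambda>l. exp (- (t * l))) g \<xi> * cis (x \<bullet> \<xi>)" for \<xi>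
    unfolding split integral_mult_right_zero integral_gauss_cis
    using t by (simp add: multiplier_def power_mult_distrib)
  have "(LINT z|lborel. of_real (gauss z) * inverse_fourier g (x - sqrt (2 * t) *\<^sub>R z)) * ?c
      = inverse_fourier (multiplier (\<lambda>l. exp (- (t * l))) g) x * ?c"
    using swap unfolding in1 in2 integral_mult_left_zero by (simp add: inverse_fourier_def)
  then show ?thesis by simp
qed

text \<open>
  An average of translates of an integrable function may be paired with a bounded function inside
  the average. With \<open>u = 1\<close> the bound says that the heat flow contracts the \<open>L\<^sup>1\<close> norm.
\<close>

lemma
  fixes w :: "'a::euclidean_space \<Rightarrow> complex"
  assumes w: "integrable lborel w" and [measurable]: "u \<in> borel_measurable borel" and u: "\<And>x. norm (u x) \<le> C"
  shows pairing_heat_swap: "(LINT x|lborel. u x * (LINT z|lborel. of_real (gauss z) * w (x - c *\<^sub>R z)))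
      = (LINT z|lborel. of_real (gauss z) * (LINT x|lborel. u x * w (x - c *\<^sub>R z)))"
    and pairing_heat_integrable: "integrable lborel (\<lambda>x. u x * (LINT z|lborel. of_real (gauss z) * w (x - c *\<^sub>R z)))"
    and pairing_heat_bound: "(LINT x|lborel. norm (u x * (LINT z|lborel. of_real (gauss z) * w (x - c *\<^sub>R z))))
      \<le> C * (LINT x|lborel. norm (w x))"
proof -
  have [measurable]: "w \<in> borel_measurable borel" using w by auto
  have C: "0 \<le> C" using u[of 0] norm_ge_zero order_trans by blast
  let ?f = "\<lambda>x z. u x * (of_real (gauss z) * w (x - c *\<^sub>R z))"
  have wi: "integrable lborel (\<lambda>x. w (x - a))" for a
    using lborel_integrable_affine[of 1 w "- a"] w by simp
  have meas: "(\<lambda>(x, z). ?f x z) \<in> borel_measurable (borel \<Otimes>\<^sub>M borel)" by measurable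
  have int: "integrable lborel (\<lambda>x. ?f x z)" for z
  proof (rule Bochner_Integration.integrable_bound)
    show "integrable lborel (\<lambda>x. of_real (C * gauss z) * w (x - c *\<^sub>R z))"
      by (intro integrable_mult_right wi)
    show "AE x in lborel. norm (?f x z) \<le> norm (of_real (C * gauss z) * w (x - c *\<^sub>R z))"
      by (rule AE_I2) (use u C in \<open>auto simp: norm_mult mult.assoc intro!: mult_right_mono\<close>)
  qed measurable
  have nt: "(LINT x|lborel. norm (w (x - a))) = (LINT x|lborel. norm (w x))" for a
    using lborel_integral_affine[of 1 "\<lambda>x. norm (w x)" "- a"] w by simp
  have bound: "(LINT x|lborel. norm (?f x z)) \<le> gauss z * (C * (LINT x|lborel. norm (w x)))" for z
  proof -
    have "(LINT x|lborel. norm (?f x z)) \<le> (LINT x|lborel. C * gauss z * norm (w (x - c *\<^sub>R z)))"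
      using u C
      by (intro integral_mono integrable_norm int integrable_mult_right wi)
         (auto simp: norm_mult mult.assoc intro!: mult_right_mono)
    then show ?thesis by (simp add: nt mult_ac)
  qed
  have B: "integrable lborel (\<lambda>z. gauss z * (C * (LINT x|lborel. norm (w x))))"
    by (intro integrable_mult_left integrable_gauss)
  have inner: "(LINT x|lborel. ?f x z) = of_real (gauss z) * (LINT x|lborel. u x * w (x - c *\<^sub>R z))" for z
    by (subst integral_mult_right_zero[symmetric]) (simp add: mult.left_commute)
  note F = meas int bound B
  show "(LINT x|lborel. u x * (LINT z|lborel. of_real (gauss z) * w (x - c *\<^sub>R z)))
      = (LINT z|lborel. of_real (gauss z) * (LINT x|lborel. u x * w (x - c *\<^sub>R z)))"
    using fubini_swap[of ?f, OF F] unfolding inner by simp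
  show "integrable lborel (\<lambda>x. u x * (LINT z|lborel. of_real (gauss z) * w (x - c *\<^sub>R z)))"
    using fubini_integrable[of ?f, OF F] by simp
  show "(LINT x|lborel. norm (u x * (LINT z|lborel. of_real (gauss z) * w (x - c *\<^sub>R z))))
      \<le> C * (LINT x|lborel. norm (w x))"
    using fubini_norm[of ?f, OF F] by (simp add: integral_gauss)
qed

text \<open>
  A common domain, on the Fourier side, for all operators that occur: the transforms of test
  functions belong to it, and it is stable under \<open>(-\<Delta>)\<^sup>s\<close> for all \<open>s > 0\<close>, which the test functions
  themselves are not. Integrability of the inverse transform is what makes the pairing with a
  bounded function meaningful.
\<close>

definition good_symbols :: "('a::euclidean_space \<Rightarrow> complex) set" where
  "good_symbols = {g. g \<in> borel_measurable borel \<and> (\<forall>k::nat.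
     integrable lborel (multiplier (\<lambda>l. l ^ k) g) \<and>
     integrable lborel (inverse_fourier (multiplier (\<lambda>l. l ^ k) g)))}"

lemma multiplier_1 [simp]: "multiplier (\<lambda>l. 1) g = g"
  by (simp add: multiplier_def fun_eq_iff)

lemma good_symbolsD:
  assumes "g \<in> good_symbols"
  shows good_symbols_measurable [measurable_dest]: "g \<in> borel_measurable borel"
    and good_symbols_integrable: "integrable lborel g"
    and good_symbols_integrable_inverse: "integrable lborel (inverse_fourier g)"
    and "integrable lborel (multiplier (\<lambda>l. l ^ k) g)"
    and "integrable lborel (inverse_fourier (multiplier (\<lambda>l. l ^ k) g))"
proof -
  have *: "g \<in> borel_measurable borel" "integrable lborel (multiplier (\<lambda>l. l ^ k) g)"
    "integrable lborel (inverse_fourier (multiplier (\<lambda>l. l ^ k) g))" for k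
    using assms by (auto simp: good_symbols_def)
  show "g \<in> borel_measurable borel" "integrable lborel (multiplier (\<lambda>l. l ^ k) g)"
    "integrable lborel (inverse_fourier (multiplier (\<lambda>l. l ^ k) g))" by (fact *)+
  show "integrable lborel g" "integrable lborel (inverse_fourier g)"
    using *(2,3)[of 0] by simp_all
qed

lemma good_symbols_norm_square: "g \<in> good_symbols \<Longrightarrow> multiplier (\<lambda>l. l) g \<in> good_symbols"
  unfolding good_symbols_def mem_Collect_eq multiplier_multiplier power_Suc2[symmetric] by (auto simp del: power_Suc)

lemma good_symbols_diff:
  assumes f: "f \<in> good_symbols" and g: "g \<in> good_symbols"
  shows "(\<lambda>\<xi>. f \<xi> - g \<xi>) \<in> good_symbols"
proof -
  have eq: "multiplier h (\<lambda>\<xi>. f \<xi> - g \<xi>) = (\<lambda>\<xi>. multiplier h f \<xi> - multiplier h g \<xi>)" for h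
    by (simp add: multiplier_def fun_eq_iff right_diff_distrib)
  have eq': "inverse_fourier (\<lambda>\<xi>. multiplier (\<lambda>l. l ^ k) f \<xi> - multiplier (\<lambda>l. l ^ k) g \<xi>)
      = (\<lambda>x. inverse_fourier (multiplier (\<lambda>l. l ^ k) f) x - inverse_fourier (multiplier (\<lambda>l. l ^ k) g) x)" for k
    by (rule ext, rule inverse_fourier_diff) (fact good_symbolsD(4)[OF f] good_symbolsD(4)[OF g])+
  note good_symbols_measurable[OF f, measurable] good_symbols_measurable[OF g, measurable]
  show ?thesis
    unfolding good_symbols_def eq eq' mem_Collect_eq
    by (intro conjI allI Bochner_Integration.integrable_diff good_symbolsD(4,5) f g) measurable
qed

lemma good_symbols_heat:
  fixes g :: "'a::euclidean_space \<Rightarrow> complex"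
  assumes g: "g \<in> good_symbols" and t: "0 \<le> t"
  shows "multiplier (\<lambda>l. exp (- (t * l))) g \<in> good_symbols"
  unfolding good_symbols_def mem_Collect_eq
proof (intro conjI allI)
  note [measurable] = good_symbols_measurable[OF g]
  show "multiplier (\<lambda>l. exp (- (t * l))) g \<in> borel_measurable borel" by measurable
  fix k
  let ?g = "multiplier (\<lambda>l. l ^ k) g"
  have eq: "multiplier (\<lambda>l. l ^ k) (multiplier (\<lambda>l. exp (- (t * l))) g) = multiplier (\<lambda>l. exp (- (t * l))) ?g"
    by (simp add: multiplier_multiplier mult.commute)
  show "integrable lborel (multiplier (\<lambda>l. l ^ k) (multiplier (\<lambda>l. exp (- (t * l))) g))"
    unfolding eq by (rule integrable_multiplier[where M = 1]) (use good_symbolsD(4)[OF g] t in auto)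
  show "integrable lborel (inverse_fourier (multiplier (\<lambda>l. l ^ k) (multiplier (\<lambda>l. exp (- (t * l))) g)))"
    unfolding eq inverse_fourier_heat[OF good_symbolsD(4)[OF g] t, abs_def]
    using pairing_heat_integrable[OF good_symbolsD(5)[OF g], of "\<lambda>x. 1" 1 k "sqrt (2 * t)"] by simp
qed

section \<open>Heat flow estimates and fractional powers\<close>

abbreviation heat :: "real \<Rightarrow> ('a::euclidean_space \<Rightarrow> complex) \<Rightarrow> 'a \<Rightarrow> complex" where
  "heat t \<equiv> multiplier (\<lambda>l. exp (- (t * l)))"

abbreviation norm_square :: "('a::euclidean_space \<Rightarrow> complex) \<Rightarrow> 'a \<Rightarrow> complex" where
  "norm_square \<equiv> multiplier (\<lambda>l. l)"

abbreviation norm_power :: "real \<Rightarrow> ('a::euclidean_space \<Rightarrow> complex) \<Rightarrow> 'a \<Rightarrow> complex" where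
  "norm_power s \<equiv> multiplier (\<lambda>l. l powr s)"

abbreviation heat_difference :: "real \<Rightarrow> ('a::euclidean_space \<Rightarrow> complex) \<Rightarrow> 'a \<Rightarrow> complex" where
  "heat_difference r \<equiv> multiplier (\<lambda>l. 1 - exp (- (r * l)))"

lemma heat_difference_eq: "heat_difference r g = (\<lambda>\<xi>. g \<xi> - heat r g \<xi>)"
  by (simp add: multiplier_def fun_eq_iff left_diff_distrib)

lemma good_symbols_heat_difference: "g \<in> good_symbols \<Longrightarrow> 0 \<le> r \<Longrightarrow> heat_difference r g \<in> good_symbols"
  unfolding heat_difference_eq by (intro good_symbols_diff good_symbols_heat)

lemma measurable_multiplier_parameter:
  fixes g :: "'a::euclidean_space \<Rightarrow> complex" and h :: "real \<Rightarrow> real \<Rightarrow> real"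
  assumes [measurable]: "(\<lambda>(t, l). h t l) \<in> borel_measurable (borel \<Otimes>\<^sub>M borel)" "g \<in> borel_measurable borel"
  shows "(\<lambda>(t, \<xi>). multiplier (h t) g \<xi>) \<in> borel_measurable (borel \<Otimes>\<^sub>M borel)"
proof -
  have "(\<lambda>(t, \<xi>). (t, (norm \<xi>)\<^sup>2)) \<in> measurable (borel \<Otimes>\<^sub>M borel :: (real \<times> 'a) measure) (borel \<Otimes>\<^sub>M borel)"
    by measurable
  from measurable_compose[OF this assms(1)]
  have [measurable]: "(\<lambda>(t, \<xi>). h t ((norm \<xi>)\<^sup>2)) \<in> borel_measurable (borel \<Otimes>\<^sub>M borel :: (real \<times> 'a) measure)"
    by (simp add: case_prod_unfold)
  show ?thesis unfolding multiplier_def[abs_def] by measurable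
qed

lemma measurable_inverse_fourier_parameter:
  fixes g :: "'a::euclidean_space \<Rightarrow> complex" and h :: "real \<Rightarrow> real \<Rightarrow> real"
  assumes "(\<lambda>(t, l). h t l) \<in> borel_measurable (borel \<Otimes>\<^sub>M borel)" "g \<in> borel_measurable borel"
  shows "(\<lambda>(x, t). inverse_fourier (multiplier (h t) g) x) \<in> borel_measurable (borel \<Otimes>\<^sub>M borel)"
  by (rule inverse_fourier_measurable_parameter[OF measurable_multiplier_parameter[OF assms]])

lemma integral_heat_difference_symbol:
  assumes "0 \<le> r"
  shows "(LINT \<tau>|lborel. of_real (indicator {0..r} \<tau>) * heat \<tau> (norm_square g) \<xi>) = heat_difference r g \<xi>"
proof -
  let ?l = "(norm \<xi>)\<^sup>2"
  have "(LINT \<tau>|lborel. of_real (indicator {0..r} \<tau>) * heat \<tau> (norm_square g) \<xi>)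
      = (LINT \<tau>|lborel. of_real (indicator {0..r} \<tau> * (?l * exp (- (\<tau> * ?l)))) * g \<xi>)"
    by (intro Bochner_Integration.integral_cong) (simp_all add: multiplier_def mult_ac)
  also have "\<dots> = of_real (LINT \<tau>|lborel. indicator {0..r} \<tau> * (?l * exp (- (\<tau> * ?l)))) * g \<xi>"
    by (simp only: integral_mult_left_zero integral_complex_of_real)
  finally show ?thesis by (simp only: integral_exp_Icc[OF assms] multiplier_def)
qed

text \<open>
  The heat equation in integrated form, from \<open>1 - exp (-r l) = \<integral>\<^sub>0\<^sup>r l exp (-\<tau> l) d\<tau>\<close>.
\<close>

lemma inverse_fourier_heat_difference:
  fixes g :: "'a::euclidean_space \<Rightarrow> complex"
  assumes g: "g \<in> good_symbols" and r: "0 \<le> r"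
  shows "inverse_fourier (heat_difference r g) x
    = (LINT \<tau>|lborel. of_real (indicator {0..r} \<tau>) * inverse_fourier (heat \<tau> (norm_square g)) x)"
proof -
  let ?G = "\<lambda>\<tau>. heat \<tau> (norm_square g)"
  let ?c = "of_real ((2 * pi) ^ DIM('a)) :: complex"
  let ?f = "\<lambda>\<xi> \<tau>. of_real (indicator {0..r} \<tau>) * (?G \<tau> \<xi> * cis (x \<bullet> \<xi>))"
  note g' = good_symbols_norm_square[OF g]
  note [measurable] = good_symbols_measurable[OF g']
  have [measurable]: "(\<lambda>(\<tau>, \<xi>). ?G \<tau> \<xi>) \<in> borel_measurable (borel \<Otimes>\<^sub>M borel)"
    by (rule measurable_multiplier_parameter) measurable
  have gi: "integrable lborel (norm_square g)" by (rule good_symbols_integrable[OF g'])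
  have swap: "(LINT \<xi>|lborel. LINT \<tau>|lborel. ?f \<xi> \<tau>) = (LINT \<tau>|lborel. LINT \<xi>|lborel. ?f \<xi> \<tau>)"
  proof (rule fubini_swap[where B = "\<lambda>\<tau>. indicator {0..r} \<tau> * (LINT \<xi>|lborel. norm (norm_square g \<xi>))"])
    show "(\<lambda>(\<xi>, \<tau>). ?f \<xi> \<tau>) \<in> borel_measurable (borel \<Otimes>\<^sub>M borel)" by measurable
    show "integrable lborel (\<lambda>\<xi>. ?f \<xi> \<tau>)" for \<tau>
    proof (cases "0 \<le> \<tau>")
      case True
      then show ?thesis
        by (intro integrable_mult_right integrable_times_cis good_symbols_integrable good_symbols_heat g')
    qed simp
    show "(LINT \<xi>|lborel. norm (?f \<xi> \<tau>)) \<le> indicator {0..r} \<tau> * (LINT \<xi>|lborel. norm (norm_square g \<xi>))" for \<tau>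
    proof (cases "\<tau> \<in> {0..r}")
      case True
      then have "(LINT \<xi>|lborel. norm (?G \<tau> \<xi>)) \<le> (LINT \<xi>|lborel. norm (norm_square g \<xi>))"
        by (intro integral_mono integrable_norm good_symbols_integrable good_symbols_heat g')
           (auto simp: multiplier_def norm_mult intro!: mult_left_le_one_le)
      with True show ?thesis by (simp add: norm_mult)
    qed simp
    show "integrable lborel (\<lambda>\<tau>. indicator {0..r} \<tau> * (LINT \<xi>|lborel. norm (norm_square g \<xi>)))"
      by (intro integrable_mult_left integrable_real_indicator) (auto simp: emeasure_lborel_Icc_eq)
  qed
  have 1: "(LINT \<tau>|lborel. ?f \<xi> \<tau>) = heat_difference r g \<xi> * cis (x \<bullet> \<xi>)" for \<xi>
    unfolding mult.assoc[symmetric] integral_mult_left_zero integral_heat_difference_symbol[OF r] ..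
  have 2: "(LINT \<xi>|lborel. ?f \<xi> \<tau>) = of_real (indicator {0..r} \<tau>) * inverse_fourier (?G \<tau>) x * ?c" for \<tau>
    by (simp add: inverse_fourier_def)
  have "inverse_fourier (heat_difference r g) x * ?c
    = (LINT \<tau>|lborel. of_real (indicator {0..r} \<tau>) * inverse_fourier (?G \<tau>) x) * ?c"
    using swap unfolding 1 2 integral_mult_left_zero by (simp add: inverse_fourier_def)
  then show ?thesis by simp
qed

text \<open>
  Integration of the representation of \<open>l\<^sup>s\<close> by exponentials against \<open>g\<close> and the plane waves. The
  interchange of integrals uses \<open>1 - exp (-r l) \<le> min 1 r * (1 + l)\<close>.
\<close>

lemma inverse_fourier_norm_power:
  fixes g :: "'a::euclidean_space \<Rightarrow> complex"
  assumes g: "g \<in> good_symbols" and s: "0 < s" "s < 1"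
  shows "of_real (levy_constant s) * inverse_fourier (norm_power s g) x
    = (LINT r|lborel. of_real (levy_kernel s r) * inverse_fourier (heat_difference r g) x)"
proof -
  let ?c = "of_real ((2 * pi) ^ DIM('a)) :: complex"
  let ?f = "\<lambda>\<xi> r. of_real (levy_kernel s r) * (heat_difference r g \<xi> * cis (x \<bullet> \<xi>))"
  note [measurable] = good_symbols_measurable[OF g]
  have [measurable]: "(\<lambda>(r, \<xi>). heat_difference r g \<xi>) \<in> borel_measurable (borel \<Otimes>\<^sub>M borel)"
    by (rule measurable_multiplier_parameter) measurable
  note gi = good_symbols_integrable[OF g] good_symbols_integrable[OF good_symbols_norm_square[OF g]]
  let ?N = "LINT \<xi>|lborel. norm (g \<xi>) + norm (norm_square g \<xi>)"
  have swap: "(LINT \<xi>|lborel. LINT r|lborel. ?f \<xi> r) = (LINT r|lborel. LINT \<xi>|lborel. ?f \<xi> r)"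
  proof (rule fubini_swap[where B = "\<lambda>r. min 1 r * levy_kernel s r * ?N"])
    show "(\<lambda>(\<xi>, r). ?f \<xi> r) \<in> borel_measurable (borel \<Otimes>\<^sub>M borel)" by measurable
    show int: "integrable lborel (\<lambda>\<xi>. ?f \<xi> r)" for r
    proof (cases "0 < r")
      case True
      then show ?thesis
        by (intro integrable_mult_right integrable_times_cis good_symbols_integrable good_symbols_heat_difference g) auto
    qed (simp add: levy_kernel_def)
    show "(LINT \<xi>|lborel. norm (?f \<xi> r)) \<le> min 1 r * levy_kernel s r * ?N" for r
    proof (cases "0 < r")
      case True
      have pt: "norm (?f \<xi> r) \<le> min 1 r * levy_kernel s r * (norm (g \<xi>) + norm (norm_square g \<xi>))" for \<xi>
      proof -
        have nn: "0 \<le> r * (norm \<xi>)\<^sup>2" using True by simp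
        have "1 - exp (- (r * (norm \<xi>)\<^sup>2)) \<le> min 1 r * (1 + (norm \<xi>)\<^sup>2)"
          by (rule order_trans[OF one_minus_exp_le_min[OF nn] min_1_mult_le]) (use True in auto)
        moreover have "0 \<le> 1 - exp (- (r * (norm \<xi>)\<^sup>2))" using nn by simp
        ultimately have le: "\<bar>1 - exp (- (r * (norm \<xi>)\<^sup>2))\<bar> \<le> min 1 r * (1 + (norm \<xi>)\<^sup>2)"
          by linarith
        have "norm (?f \<xi> r) = levy_kernel s r * (\<bar>1 - exp (- (r * (norm \<xi>)\<^sup>2))\<bar> * norm (g \<xi>))"
          by (simp only: norm_mult norm_multiplier norm_cis mult_1_right norm_of_real abs_of_nonneg[OF levy_kernel_nonneg])
        also have "\<dots> \<le> levy_kernel s r * (min 1 r * (1 + (norm \<xi>)\<^sup>2) * norm (g \<xi>))"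
          by (intro mult_left_mono mult_right_mono le) auto
        also have "\<dots> = min 1 r * levy_kernel s r * (norm (g \<xi>) + norm (norm_square g \<xi>))"
          by (simp only: norm_multiplier abs_of_nonneg[OF zero_le_power2]) (simp only: distrib_left distrib_right mult_1 mult_ac)
        finally show ?thesis .
      qed
      have "(LINT \<xi>|lborel. norm (?f \<xi> r))
          \<le> (LINT \<xi>|lborel. min 1 r * levy_kernel s r * (norm (g \<xi>) + norm (norm_square g \<xi>)))"
        by (intro integral_mono integrable_norm int pt integrable_mult_right Bochner_Integration.integrable_add gi)
      then show ?thesis by simp
    qed (simp add: levy_kernel_def)
    show "integrable lborel (\<lambda>r. min 1 r * levy_kernel s r * ?N)"
      by (intro integrable_mult_left integrable_min_levy_kernel s)
  qed
  have 1: "(LINT r|lborel. ?f \<xi> r) = of_real (levy_constant s) * norm_power s g \<xi> * cis (x \<bullet> \<xi>)" for \<xi>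
  proof -
    have "(LINT r|lborel. ?f \<xi> r)
        = (LINT r|lborel. of_real ((1 - exp (- (r * (norm \<xi>)\<^sup>2))) * levy_kernel s r) * (g \<xi> * cis (x \<bullet> \<xi>)))"
      by (intro Bochner_Integration.integral_cong) (simp_all add: multiplier_def mult_ac)
    also have "\<dots> = of_real (levy_constant s * ((norm \<xi>)\<^sup>2) powr s) * (g \<xi> * cis (x \<bullet> \<xi>))"
      by (simp only: integral_mult_left_zero integral_complex_of_real levy_representation[OF s zero_le_power2])
    finally show ?thesis by (simp add: multiplier_def mult_ac)
  qed
  have 2: "(LINT \<xi>|lborel. ?f \<xi> r) = of_real (levy_kernel s r) * inverse_fourier (heat_difference r g) x * ?c" for r
    by (simp add: inverse_fourier_def)
  have "of_real (levy_constant s) * inverse_fourier (norm_power s g) x * ?c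
    = (LINT r|lborel. of_real (levy_kernel s r) * inverse_fourier (heat_difference r g) x) * ?c"
    using swap unfolding 1 2 integral_mult_left_zero by (simp add: inverse_fourier_def mult.assoc)
  then show ?thesis by simp
qed

lemma integral_norm_inverse_fourier_heat:
  fixes g :: "'a::euclidean_space \<Rightarrow> complex"
  assumes "g \<in> good_symbols" "0 \<le> t"
  shows "(LINT x|lborel. norm (inverse_fourier (heat t g) x)) \<le> (LINT x|lborel. norm (inverse_fourier g x))"
  using pairing_heat_bound[of "inverse_fourier g" "\<lambda>x. 1" 1 "sqrt (2 * t)"] assms
  by (simp add: good_symbolsD inverse_fourier_heat)

definition pairing :: "('a::euclidean_space \<Rightarrow> complex) \<Rightarrow> ('a \<Rightarrow> complex) \<Rightarrow> complex" where
  "pairing u g = (LINT x|lborel. u x * inverse_fourier g x)"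

locale bounded_function =
  fixes u :: "'a::euclidean_space \<Rightarrow> complex" and C :: real
  assumes measurable_u [measurable]: "u \<in> borel_measurable borel" and bound_u: "norm (u x) \<le> C"
begin

lemma C_nonneg: "0 \<le> C"
  using bound_u[of 0] norm_ge_zero order_trans by blast

lemma
  assumes w: "integrable lborel w"
  shows integrable_u_times: "integrable lborel (\<lambda>x. u x * w x)"
    and norm_integral_u_times: "(LINT x|lborel. norm (u x * w x)) \<le> C * (LINT x|lborel. norm (w x))"
proof -
  have [measurable]: "w \<in> borel_measurable borel" using w by auto
  show i: "integrable lborel (\<lambda>x. u x * w x)"
    by (rule Bochner_Integration.integrable_bound[OF integrable_mult_right[OF w, of "of_real C"]])
       (use bound_u C_nonneg in \<open>auto simp: norm_mult intro!: AE_I2 mult_right_mono\<close>)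
  have "(LINT x|lborel. norm (u x * w x)) \<le> (LINT x|lborel. C * norm (w x))"
    using bound_u by (intro integral_mono integrable_norm i integrable_mult_right w)
      (auto simp: norm_mult intro!: mult_right_mono)
  then show "(LINT x|lborel. norm (u x * w x)) \<le> C * (LINT x|lborel. norm (w x))" by simp
qed

lemma norm_pairing: "g \<in> good_symbols \<Longrightarrow> norm (pairing u g) \<le> C * (LINT x|lborel. norm (inverse_fourier g x))"
  unfolding pairing_def
  by (rule order_trans[OF integral_norm_bound norm_integral_u_times[OF good_symbols_integrable_inverse]])

lemma pairing_diff:
  assumes "f \<in> good_symbols" "g \<in> good_symbols"
  shows "pairing u (\<lambda>\<xi>. f \<xi> - g \<xi>) = pairing u f - pairing u g"
  unfolding pairing_def using assms
  by (simp add: inverse_fourier_diff good_symbolsD right_diff_distrib integrable_u_times)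

lemma
  assumes g: "g \<in> good_symbols" and r: "0 \<le> r"
  shows pairing_heat_difference:
      "pairing u g - pairing u (heat r g) = (LINT \<tau>|lborel. of_real (indicator {0..r} \<tau>) * pairing u (heat \<tau> (norm_square g)))"
    and norm_u_heat_difference:
      "(LINT x|lborel. norm (u x * inverse_fourier (heat_difference r g) x))
        \<le> r * (C * (LINT x|lborel. norm (inverse_fourier (norm_square g) x)))"
proof -
  note g' = good_symbols_norm_square[OF g]
  note [measurable] = good_symbols_measurable[OF g']
  let ?G = "\<lambda>\<tau>. heat \<tau> (norm_square g)"
  let ?f = "\<lambda>x \<tau>. of_real (indicator {0..r} \<tau>) * (u x * inverse_fourier (?G \<tau>) x)"
  let ?N = "C * (LINT x|lborel. norm (inverse_fourier (norm_square g) x))"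
  have [measurable]: "(\<lambda>(x, \<tau>). inverse_fourier (?G \<tau>) x) \<in> borel_measurable (borel \<Otimes>\<^sub>M borel)"
    by (rule measurable_inverse_fourier_parameter) measurable
  have meas: "(\<lambda>(x, \<tau>). ?f x \<tau>) \<in> borel_measurable (borel \<Otimes>\<^sub>M borel)" by measurable
  have int: "integrable lborel (\<lambda>x. ?f x \<tau>)" for \<tau>
  proof (cases "0 \<le> \<tau>")
    case True
    then show ?thesis
      by (intro integrable_mult_right integrable_u_times good_symbols_integrable_inverse good_symbols_heat g')
  qed simp
  have bound: "(LINT x|lborel. norm (?f x \<tau>)) \<le> indicator {0..r} \<tau> * ?N" for \<tau>
  proof (cases "\<tau> \<in> {0..r}")
    case True
    then have "(LINT x|lborel. norm (u x * inverse_fourier (?G \<tau>) x)) \<le> C * (LINT x|lborel. norm (inverse_fourier (?G \<tau>) x))"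
      by (intro norm_integral_u_times good_symbols_integrable_inverse good_symbols_heat g') auto
    also have "\<dots> \<le> ?N"
      using True by (intro mult_left_mono C_nonneg integral_norm_inverse_fourier_heat g') auto
    finally show ?thesis using True by (simp add: norm_mult)
  qed simp
  have B: "integrable lborel (\<lambda>\<tau>. indicator {0..r} \<tau> * ?N)"
    by (intro integrable_mult_left integrable_real_indicator) (auto simp: emeasure_lborel_Icc_eq)
  note F = meas int bound B
  have eq: "u x * inverse_fourier (heat_difference r g) x = (LINT \<tau>|lborel. ?f x \<tau>)" for x
    unfolding inverse_fourier_heat_difference[OF g r]
    by (subst integral_mult_right_zero[symmetric]) (simp add: mult.left_commute)
  have "pairing u g - pairing u (heat r g) = pairing u (heat_difference r g)"
    unfolding heat_difference_eq using g r by (intro pairing_diff[symmetric] good_symbols_heat)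
  also have "\<dots> = (LINT x|lborel. LINT \<tau>|lborel. ?f x \<tau>)"
    unfolding pairing_def eq ..
  also have "\<dots> = (LINT \<tau>|lborel. LINT x|lborel. ?f x \<tau>)"
    by (rule fubini_swap[OF F])
  finally show "pairing u g - pairing u (heat r g) = (LINT \<tau>|lborel. of_real (indicator {0..r} \<tau>) * pairing u (?G \<tau>))"
    by (simp add: pairing_def)
  show "(LINT x|lborel. norm (u x * inverse_fourier (heat_difference r g) x)) \<le> r * ?N"
    unfolding eq using fubini_norm[of ?f, OF F] r by simp
qed

text \<open>
  For small \<open>r\<close> the heat equation gives a factor \<open>r\<close>, for large \<open>r\<close> the contraction property gives a
  uniform bound. The resulting factor \<open>min 1 r\<close> is integrable against the Levy kernel.
\<close>

lemma norm_u_heat_difference_min: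
  assumes g: "g \<in> good_symbols" and r: "0 < r"
  shows "(LINT x|lborel. norm (u x * inverse_fourier (heat_difference r g) x))
        \<le> min 1 r * (C * (2 * (LINT x|lborel. norm (inverse_fourier g x))
            + (LINT x|lborel. norm (inverse_fourier (norm_square g) x))))" (is "?L \<le> _ * (C * (2 * ?N + ?M))")
proof -
  note gi = good_symbols_integrable_inverse[OF g]
  have gh: "heat r g \<in> good_symbols" using g r by (intro good_symbols_heat) auto
  note ghi = good_symbols_integrable_inverse[OF gh]
  have nn: "0 \<le> ?N" "0 \<le> ?M" by (auto intro!: integral_nonneg_AE)
  have "?L \<le> C * (LINT x|lborel. norm (inverse_fourier (heat_difference r g) x))"
    using g r by (intro norm_integral_u_times good_symbols_integrable_inverse good_symbols_heat_difference) auto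
  also have "(LINT x|lborel. norm (inverse_fourier (heat_difference r g) x))
      \<le> (LINT x|lborel. norm (inverse_fourier g x) + norm (inverse_fourier (heat r g) x))"
    using g r by (intro integral_mono integrable_norm Bochner_Integration.integrable_add gi ghi
          good_symbols_integrable_inverse good_symbols_heat_difference)
       (auto simp: heat_difference_eq inverse_fourier_diff good_symbols_integrable gh intro: norm_triangle_ineq4)
  also have "\<dots> = ?N + (LINT x|lborel. norm (inverse_fourier (heat r g) x))"
    by (intro Bochner_Integration.integral_add integrable_norm gi ghi)
  also have "\<dots> \<le> ?N + ?N"
    using r by (intro add_left_mono integral_norm_inverse_fourier_heat g) auto
  finally have "?L \<le> C * (2 * ?N)" using C_nonneg by (simp add: mult_left_mono)
  also have "\<dots> \<le> C * (2 * ?N + ?M)" using nn C_nonneg by (intro mult_left_mono) auto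
  finally have 1: "?L \<le> C * (2 * ?N + ?M)" .
  have "?L \<le> r * (C * ?M)" using norm_u_heat_difference[OF g] r by simp
  also have "\<dots> \<le> r * (C * (2 * ?N + ?M))" using nn C_nonneg r by (intro mult_left_mono) auto
  finally show ?thesis using 1 by (cases "r \<le> 1") auto
qed

lemma
  assumes g: "g \<in> good_symbols" and s: "0 < s" "s < 1"
  shows integrable_u_norm_power: "integrable lborel (\<lambda>x. u x * inverse_fourier (norm_power s g) x)"
    and levy_pairing_norm_power: "of_real (levy_constant s) * pairing u (norm_power s g)
      = (LINT r|lborel. of_real (levy_kernel s r) * (pairing u g - pairing u (heat r g)))"
proof -
  note [measurable] = good_symbols_measurable[OF g]
  let ?f = "\<lambda>x r. of_real (levy_kernel s r) * (u x * inverse_fourier (heat_difference r g) x)"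
  let ?K = "C * (2 * (LINT x|lborel. norm (inverse_fourier g x))
            + (LINT x|lborel. norm (inverse_fourier (norm_square g) x)))"
  have [measurable]: "(\<lambda>(x, r). inverse_fourier (heat_difference r g) x) \<in> borel_measurable (borel \<Otimes>\<^sub>M borel)"
    by (rule measurable_inverse_fourier_parameter) measurable
  have meas: "(\<lambda>(x, r). ?f x r) \<in> borel_measurable (borel \<Otimes>\<^sub>M borel)" by measurable
  have int: "integrable lborel (\<lambda>x. ?f x r)" for r
  proof (cases "0 < r")
    case True
    then show ?thesis
      by (intro integrable_mult_right integrable_u_times good_symbols_integrable_inverse good_symbols_heat_difference g) auto
  qed (simp add: levy_kernel_def)
  have bound: "(LINT x|lborel. norm (?f x r)) \<le> min 1 r * levy_kernel s r * ?K" for r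
  proof (cases "0 < r")
    case True
    have "(LINT x|lborel. norm (?f x r)) = levy_kernel s r * (LINT x|lborel. norm (u x * inverse_fourier (heat_difference r g) x))"
      by (simp add: norm_mult)
    also have "\<dots> \<le> levy_kernel s r * (min 1 r * ?K)"
      by (intro mult_left_mono norm_u_heat_difference_min g True) simp
    finally show ?thesis by (simp add: mult_ac)
  qed (simp add: levy_kernel_def)
  have B: "integrable lborel (\<lambda>r. min 1 r * levy_kernel s r * ?K)"
    by (intro integrable_mult_left integrable_min_levy_kernel s)
  note F = meas int bound B
  have eq: "of_real (levy_constant s) * (u x * inverse_fourier (norm_power s g) x) = (LINT r|lborel. ?f x r)" for x
    unfolding mult.left_commute[of _ "u x"] inverse_fourier_norm_power[OF g s] integral_mult_right_zero ..
  have "integrable lborel (\<lambda>x. of_real (levy_constant s) * (u x * inverse_fourier (norm_power s g) x))"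
    unfolding eq by (rule fubini_integrable[OF F])
  from integrable_mult_right[OF this, of "of_real (inverse (levy_constant s))"]
  show "integrable lborel (\<lambda>x. u x * inverse_fourier (norm_power s g) x)"
    using levy_constant_pos[OF s] by (simp add: mult.assoc[symmetric] flip: of_real_mult)
  have "of_real (levy_constant s) * pairing u (norm_power s g) = (LINT x|lborel. LINT r|lborel. ?f x r)"
    unfolding pairing_def integral_mult_right_zero[symmetric] eq ..
  also have "\<dots> = (LINT r|lborel. LINT x|lborel. ?f x r)"
    by (rule fubini_swap[OF F])
  also have "\<dots> = (LINT r|lborel. of_real (levy_kernel s r) * (pairing u g - pairing u (heat r g)))"
  proof (rule Bochner_Integration.integral_cong[OF refl])
    fix r
    have "pairing u (heat_difference r g) = pairing u g - pairing u (heat r g)" if "0 < r"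
      unfolding heat_difference_eq using g that by (intro pairing_diff good_symbols_heat) auto
    then show "(LINT x|lborel. ?f x r) = of_real (levy_kernel s r) * (pairing u g - pairing u (heat r g))"
      by (cases "0 < r") (auto simp: pairing_def levy_kernel_def)
  qed
  finally show "of_real (levy_constant s) * pairing u (norm_power s g)
      = (LINT r|lborel. of_real (levy_kernel s r) * (pairing u g - pairing u (heat r g)))" .
qed

end

text \<open>
  Integrability of the inverse transform is \<open>integrable_u_norm_power\<close> for the constant function \<open>u = 1\<close>.
\<close>

lemma good_symbols_norm_power:
  fixes g :: "'a::euclidean_space \<Rightarrow> complex"
  assumes g: "g \<in> good_symbols" and s: "0 < s" "s < 1"
  shows "norm_power s g \<in> good_symbols"
  unfolding good_symbols_def mem_Collect_eq
proof (intro conjI allI)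
  have bounded: "bounded_function (\<lambda>x::'a. 1) 1" by (simp add: bounded_function_def)
  note [measurable] = good_symbols_measurable[OF g]
  show "norm_power s g \<in> borel_measurable borel" by measurable
  fix k
  have gk: "multiplier (\<lambda>l. l ^ k) g \<in> good_symbols"
  proof (induction k)
    case (Suc k)
    show ?case using good_symbols_norm_square[OF Suc] by (simp add: multiplier_multiplier)
  qed (simp add: g)
  have eq: "multiplier (\<lambda>l. l ^ k) (norm_power s g) = norm_power s (multiplier (\<lambda>l. l ^ k) g)"
    by (simp add: multiplier_multiplier mult.commute)
  show "integrable lborel (inverse_fourier (multiplier (\<lambda>l. l ^ k) (norm_power s g)))"
    unfolding eq using bounded_function.integrable_u_norm_power[OF bounded gk s] by simp
  show "integrable lborel (multiplier (\<lambda>l. l ^ k) (norm_power s g))"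
    unfolding eq
  proof (rule Bochner_Integration.integrable_bound)
    let ?g = "multiplier (\<lambda>l. l ^ k) g"
    show "integrable lborel (\<lambda>\<xi>. norm (?g \<xi>) + norm (norm_square ?g \<xi>))"
      by (intro Bochner_Integration.integrable_add integrable_norm good_symbols_integrable good_symbols_norm_square gk)
    have "l powr s \<le> 1 + l" if "0 \<le> l" for l
    proof (cases "l \<le> 1")
      case True
      then show ?thesis using powr_le1[of s l] s that by simp
    next
      case False
      then show ?thesis using powr_mono[of s 1 l] s by simp
    qed
    from mult_right_mono[OF this]
    show "AE \<xi> in lborel. norm (norm_power s ?g \<xi>) \<le> norm (norm (?g \<xi>) + norm (norm_square ?g \<xi>))"
      by (intro AE_I2) (simp add: multiplier_def[of _ "multiplier _ _"] norm_mult norm_power distrib_right)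
  qed measurable
qed

section \<open>Two uniqueness results on the half-line\<close>

text \<open>
  The equation \<open>d' = a d\<close> is stated in integrated form, which is the form that the heat flow provides.
\<close>

lemma linear_ode_unique:
  fixes d :: "real \<Rightarrow> complex"
  assumes cont: "continuous_on {0..} d"
    and ode: "\<And>r. 0 \<le> r \<Longrightarrow> d r = d 0 + of_real a * (LINT \<tau>|lborel. of_real (indicator {0..r} \<tau>) * d \<tau>)"
    and r: "0 \<le> r"
  shows "d r = d 0 * of_real (exp (a * r))"
proof -
  define y where "y t = of_real (exp (- a * t)) * d t" for t
  have int: "(LINT \<tau>|lborel. of_real (indicator {0..t} \<tau>) * d \<tau>) = integral {0..t} d" if "0 \<le> t" for t
  proof -
    have "set_integrable lborel {0..t} d"
      unfolding set_integrable_def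
      by (rule borel_integrable_compact) (auto intro: continuous_on_subset[OF cont])
    from set_borel_integral_eq_integral(2)[OF this] show ?thesis
      by (simp add: set_lebesgue_integral_def scaleR_conv_of_real)
  qed
  have dd: "(d has_vector_derivative of_real a * d t) (at t within {0..r})" if t: "t \<in> {0..r}" for t
  proof -
    have "((\<lambda>t. d 0 + of_real a * integral {0..t} d) has_vector_derivative (0 + of_real a * d t)) (at t within {0..r})"
      by (intro has_vector_derivative_add has_vector_derivative_const has_vector_derivative_mult_right
          integral_has_vector_derivative continuous_on_subset[OF cont] t) auto
    then have "((\<lambda>t. d 0 + of_real a * integral {0..t} d) has_vector_derivative of_real a * d t) (at t within {0..r})"
      by simp
    then show ?thesis
    proof (rule has_vector_derivative_transform[OF t, rotated])
      fix x assume "x \<in> {0..r}"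
      then have x: "0 \<le> x" by simp
      show "d x = d 0 + of_real a * integral {0..x} d" using ode[OF x] unfolding int[OF x] .
    qed
  qed
  have "(y has_vector_derivative 0) (at t within {0..r})" if t: "t \<in> {0..r}" for t
  proof -
    have "((\<lambda>t. complex_of_real (exp (- a * t))) has_vector_derivative of_real (- a * exp (- a * t))) (at t within {0..r})"
      by (intro has_vector_derivative_of_real)
         (auto intro!: derivative_eq_intros simp: has_real_derivative_iff_has_vector_derivative[symmetric])
    from has_vector_derivative_mult[OF this dd[OF t]] show ?thesis
      by (simp add: y_def[abs_def] algebra_simps)
  qed
  then obtain c where c: "\<And>t. t \<in> {0..r} \<Longrightarrow> y t = c"
    using has_vector_derivative_zero_constant[of "{0..r}" y] by (metis convex_real_interval(5))
  have "y r = y 0" using c r by simp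
  then have "of_real (exp (- (a * r))) * d r = d 0" by (simp add: y_def)
  then have "of_real (exp (a * r)) * of_real (exp (- (a * r))) * d r = of_real (exp (a * r)) * d 0"
    by (simp add: mult.assoc)
  then show ?thesis by (simp add: mult.commute flip: of_real_mult exp_add)
qed

text \<open>
  A bounded Lipschitz function on the half-line with \<open>(-d/dt)\<^sup>s d = -d\<close> vanishes. Where \<open>|d|\<close> almost
  attains its supremum, \<open>d(t) - d(t + r)\<close>, rotated so that \<open>d(t)\<close> is positive, has a real part that is
  bounded below by a small negative number; so the left-hand side is almost nonnegative, whereas the
  right-hand side is negative unless the supremum is zero. The Lipschitz bound controls the
  singularity of the kernel at \<open>r = 0\<close>.
\<close>

lemma fractional_maximum_principle:
  fixes d :: "real \<Rightarrow> complex"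
  assumes s: "0 < s" "s < 1" and c: "0 < c"
    and [measurable]: "d \<in> borel_measurable borel"
    and bound: "\<And>t. 0 \<le> t \<Longrightarrow> norm (d t) \<le> M"
    and lip: "\<And>t r. 0 \<le> t \<Longrightarrow> 0 \<le> r \<Longrightarrow> norm (d t - d (t + r)) \<le> K * r"
    and eq: "\<And>t. 0 \<le> t \<Longrightarrow> (LINT r|lborel. of_real (levy_kernel s r) * (d t - d (t + r))) = - of_real c * d t"
    and t: "0 \<le> t"
  shows "d t = 0"
proof -
  define S where "S = (SUP t\<in>{0..}. norm (d t))"
  have bdd: "bdd_above ((\<lambda>t. norm (d t)) ` {0..})" using bound by (intro bdd_aboveI2) auto
  have S: "norm (d t) \<le> S" if "0 \<le> t" for t
    unfolding S_def by (rule cSUP_upper[OF _ bdd]) (use that in auto)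
  have M: "0 \<le> M" using bound[of 0] norm_ge_zero order_trans by blast
  have K: "0 \<le> K" using order_trans[OF norm_ge_zero lip[of 0 1]] by simp
  define m where "m e r = min e (K * r) * levy_kernel s r" for e r :: real
  have m_le: "\<bar>m e r\<bar> \<le> max 1 K * (min 1 r * levy_kernel s r)" if "0 \<le> e" "e \<le> 1" for e r
  proof (cases "0 < r")
    case True
    have "min e (K * r) \<le> max 1 K * min 1 r"
    proof (cases "r \<le> 1")
      case True
      then show ?thesis using \<open>0 < r\<close> by (auto simp: min_le_iff_disj intro!: mult_right_mono)
    qed (use that in auto)
    moreover have "0 \<le> min e (K * r)" using that K True by simp
    ultimately show ?thesis unfolding m_def by (simp add: abs_mult mult_right_mono flip: mult.assoc)
  qed (simp add: m_def levy_kernel_def)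
  have mm [measurable]: "m e \<in> borel_measurable borel" for e unfolding m_def[abs_def] by measurable
  have w: "integrable lborel (\<lambda>r. max 1 K * (min 1 r * levy_kernel s r))"
    by (intro integrable_mult_right integrable_min_levy_kernel s)
  have mi: "integrable lborel (m e)" if "0 \<le> e" "e \<le> 1" for e
    by (rule Bochner_Integration.integrable_bound[OF w])
       (use m_le[OF that] in \<open>auto intro: order_trans[OF _ abs_ge_self]\<close>)
  have key: "c * (S - e) \<le> (LINT r|lborel. m e r)" if e: "0 < e" "e \<le> 1" for e
  proof -
    have "S - e < (SUP t\<in>{0..}. norm (d t))" using e by (simp add: S_def)
    then have "\<exists>t\<in>{0..}. S - e < norm (d t)"
      by (rule less_cSUP_iff[OF _ bdd, THEN iffD1, rotated]) simp
    then obtain t where t: "0 \<le> t" "S - e < norm (d t)" by auto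
    \<comment> \<open>The rotation that makes \<open>d t\<close> real and nonnegative.\<close>
    define q where "q = cnj (sgn (d t))"
    have q: "norm q \<le> 1" by (simp add: q_def norm_sgn)
    have qd: "q * d t = of_real (norm (d t))"
      by (simp add: q_def sgn_eq complex_norm_square[symmetric] power2_eq_square mult.commute) 
    have low: "- m e r \<le> Re (q * (of_real (levy_kernel s r) * (d t - d (t + r))))" for r
    proof (cases "0 < r")
      case True
      have "Re (q * d (t + r)) \<le> norm q * norm (d (t + r))"
        by (metis complex_Re_le_cmod norm_mult)
      also have "\<dots> \<le> 1 * S" by (intro mult_mono q S) (use t True in auto)
      finally have 1: "- e \<le> Re (q * (d t - d (t + r)))" using t by (simp add: right_diff_distrib qd)
      have "\<bar>Re (q * (d t - d (t + r)))\<bar> \<le> norm q * norm (d t - d (t + r))"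
        by (metis abs_Re_le_cmod norm_mult)
      also have "\<dots> \<le> 1 * (K * r)" by (intro mult_mono q lip) (use t True in auto)
      finally have "- (K * r) \<le> Re (q * (d t - d (t + r)))" by simp
      with 1 have "- min e (K * r) \<le> Re (q * (d t - d (t + r)))" by simp
      from mult_left_mono[OF this levy_kernel_nonneg[of s r]]
      have "- m e r \<le> levy_kernel s r * Re (q * (d t - d (t + r)))" by (simp add: m_def mult.commute)
      then show ?thesis by (simp add: mult.left_commute[of q])
    qed (simp add: m_def levy_kernel_def)
    have "integrable lborel (\<lambda>r. levy_kernel s r *\<^sub>R (d t - d (t + r)))"
    proof (rule integrable_bounded_levy_kernel[OF s, where M = "2 * M + K"])
      fix r :: real assume r: "0 < r"
      have 1: "norm (d t - d (t + r)) \<le> M + M"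
        by (rule order_trans[OF norm_triangle_ineq4 add_mono[OF bound bound]]) (use t r in auto)
      show "norm (d t - d (t + r)) \<le> (2 * M + K) * min 1 r"
      proof (cases "r \<le> 1")
        case True
        have "norm (d t - d (t + r)) \<le> K * r" using lip t r by simp
        also have "\<dots> \<le> (2 * M + K) * r" using M r by (intro mult_right_mono) auto
        finally show ?thesis using True by simp
      qed (use 1 K in simp)
    qed measurable
    then have i: "integrable lborel (\<lambda>r. q * (of_real (levy_kernel s r) * (d t - d (t + r))))"
      by (intro integrable_mult_right) (simp add: scaleR_conv_of_real)
    have "- (LINT r|lborel. m e r) = (LINT r|lborel. - m e r)" by simp
    also have "\<dots> \<le> (LINT r|lborel. Re (q * (of_real (levy_kernel s r) * (d t - d (t + r)))))"
      using mi e by (intro integral_mono low integrable_Re i integrable_minus) auto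
    also have "\<dots> = Re (q * (LINT r|lborel. of_real (levy_kernel s r) * (d t - d (t + r))))"
      using i by (subst integral_Re) simp_all
    also have "\<dots> = - c * norm (d t)"
      using eq[OF t(1)] by (simp add: mult.left_commute[of q] qd)
    finally have "c * norm (d t) \<le> (LINT r|lborel. m e r)" by simp
    moreover have "c * (S - e) \<le> c * norm (d t)" using t c by (intro mult_left_mono) auto
    ultimately show ?thesis by simp
  qed
  define e where "e n = inverse (real (Suc n))" for n
  have e: "0 < e n" "e n \<le> 1" for n by (auto simp: e_def divide_simps)
  have e0: "e \<longlonglongrightarrow> 0" unfolding e_def by (rule LIMSEQ_inverse_real_of_nat)
  have "(\<lambda>n. LINT r|lborel. m (e n) r) \<longlonglongrightarrow> (LINT r|lborel. m 0 r)"
  proof (rule integral_dominated_convergence[OF _ _ w])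
    show "AE r in lborel. (\<lambda>n. m (e n) r) \<longlonglongrightarrow> m 0 r"
      unfolding m_def by (intro AE_I2 tendsto_intros e0)
    show "AE r in lborel. norm (m (e n) r) \<le> max 1 K * (min 1 r * levy_kernel s r)" for n
      using m_le e[of n] by (auto intro!: AE_I2)
  qed measurable
  moreover have "(LINT r|lborel. m 0 r) = 0"
  proof -
    have "m 0 r = 0" for r using K by (cases "0 < r") (auto simp: m_def levy_kernel_def min_def)
    then show ?thesis by simp
  qed
  moreover have "(\<lambda>n. c * (S - e n)) \<longlonglongrightarrow> c * (S - 0)" by (intro tendsto_intros e0)
  ultimately have "c * S \<le> 0"
    by (intro LIMSEQ_le[where X = "\<lambda>n. c * (S - e n)" and Y = "\<lambda>n. LINT r|lborel. m (e n) r"]) (use key e in auto)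
  then have "S \<le> 0" using c by (simp add: mult_le_0_iff)
  with S[OF t] have "norm (d t) \<le> 0" by (rule order_trans)
  then show ?thesis by simp
qed

section \<open>Passing between the exponents\<close>

lemma multiplier_diff:
  "multiplier h (\<lambda>\<xi>. f \<xi> - g \<xi>) = (\<lambda>\<xi>. multiplier h f \<xi> - multiplier h g \<xi>)"
  by (simp add: multiplier_def fun_eq_iff right_diff_distrib)

lemma multiplier_commute: "multiplier h (multiplier k g) = multiplier k (multiplier h g)"
  by (simp add: multiplier_def fun_eq_iff mult.left_commute)

lemma heat_heat: "heat a (heat b g) = heat (a + b) g"
  by (simp add: multiplier_multiplier exp_add[symmetric] algebra_simps)

lemma norm_power_norm_power: "norm_power a (norm_power b g) = norm_power (a + b) g"
  by (simp add: multiplier_multiplier powr_add)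

lemma norm_power_1: "norm_power 1 g = norm_square g"
  by (rule multiplier_cong) simp

text \<open>
  The integer part of the exponent is a power of \<open>|\<xi>|\<^sup>2\<close>, under which the class is closed by
  definition.
\<close>

lemma good_symbols_norm_power_pos:
  assumes g: "g \<in> good_symbols" and s: "0 < s"
  shows "norm_power s g \<in> good_symbols"
proof -
  have *: "\<forall>s>0. s \<le> real (Suc n) \<longrightarrow> norm_power s g \<in> good_symbols" for n
  proof (induction n)
    case 0
    show ?case
    proof (intro allI impI)
      fix s :: real assume "0 < s" "s \<le> real (Suc 0)"
      then consider "0 < s" "s < 1" | "s = 1" by force
      then show "norm_power s g \<in> good_symbols"
      proof cases
        case 2
        show ?thesis unfolding 2 norm_power_1 by (rule good_symbols_norm_square[OF g])
      qed (rule good_symbols_norm_power[OF g])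
    qed
  next
    case (Suc n)
    show ?case
    proof (intro allI impI)
      fix s :: real assume s: "0 < s" "s \<le> real (Suc (Suc n))"
      show "norm_power s g \<in> good_symbols"
      proof (cases "s \<le> real (Suc n)")
        case False
        then have "norm_power (s - 1) g \<in> good_symbols" using Suc s by simp
        from good_symbols_norm_square[OF this] show ?thesis
          unfolding norm_power_1[symmetric] norm_power_norm_power by simp
      qed (use Suc s in blast)
    qed
  qed
  obtain n where "s \<le> real n" using real_arch_simple by blast
  then show ?thesis using *[of n] s by simp
qed

context bounded_function
begin

lemma borel_measurable_pairing_heat:
  assumes g: "g \<in> good_symbols"
  shows "(\<lambda>t. pairing u (heat t g)) \<in> borel_measurable borel"
proof -
  note [measurable] = good_symbols_measurable[OF g]
  have [measurable]: "(\<lambda>(x, t). inverse_fourier (heat t g) x) \<in> borel_measurable (borel \<Otimes>\<^sub>M borel)"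
    by (rule measurable_inverse_fourier_parameter) measurable
  show ?thesis unfolding pairing_def by measurable
qed

lemma norm_pairing_heat:
  assumes "g \<in> good_symbols" "0 \<le> t"
  shows "norm (pairing u (heat t g)) \<le> C * (LINT x|lborel. norm (inverse_fourier g x))"
  by (rule order_trans[OF norm_pairing[OF good_symbols_heat] mult_left_mono])
     (use assms C_nonneg in \<open>auto intro: integral_norm_inverse_fourier_heat\<close>)

lemma pairing_heat_lipschitz:
  assumes g: "g \<in> good_symbols" and t: "0 \<le> t" and r: "0 \<le> r"
  shows "norm (pairing u (heat t g) - pairing u (heat (t + r) g))
    \<le> C * (LINT x|lborel. norm (inverse_fourier (norm_square g) x)) * r"
proof -
  note h = good_symbols_heat[OF g t]
  have "norm (pairing u (heat t g) - pairing u (heat (t + r) g)) = norm (pairing u (heat_difference r (heat t g)))"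
    using pairing_diff[OF h good_symbols_heat[OF h r]] by (simp only: heat_difference_eq heat_heat add.commute)
  also have "\<dots> \<le> r * (C * (LINT x|lborel. norm (inverse_fourier (norm_square (heat t g)) x)))"
    unfolding pairing_def by (rule order_trans[OF integral_norm_bound norm_u_heat_difference[OF h r]])
  also have "\<dots> \<le> r * (C * (LINT x|lborel. norm (inverse_fourier (norm_square g) x)))"
    unfolding multiplier_commute[of "\<lambda>l. l"]
    by (intro mult_left_mono C_nonneg r integral_norm_inverse_fourier_heat good_symbols_norm_square g t)
  finally show ?thesis by (simp add: mult_ac)
qed

lemma continuous_on_pairing_heat:
  assumes g: "g \<in> good_symbols"
  shows "continuous_on {0..} (\<lambda>t. pairing u (heat t g))"
proof (rule lipschitz_on_continuous_on[OF lipschitz_onI])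
  let ?K = "C * (LINT x|lborel. norm (inverse_fourier (norm_square g) x))"
  show "0 \<le> ?K" using C_nonneg by (auto intro!: mult_nonneg_nonneg integral_nonneg_AE)
  fix x y :: real assume "x \<in> {0..}" "y \<in> {0..}"
  then show "dist (pairing u (heat x g)) (pairing u (heat y g)) \<le> ?K * dist x y"
    using pairing_heat_lipschitz[OF g, of x "y - x"] pairing_heat_lipschitz[OF g, of y "x - y"]
    by (cases "x \<le> y") (auto simp: dist_norm norm_minus_commute abs_minus_commute)
qed

lemma pairing_norm_power:
  assumes g: "g \<in> good_symbols" and s: "0 < s" "s < 1" and t: "0 \<le> t"
  shows "of_real (levy_constant s) * pairing u (heat t (norm_power s g))
    = (LINT r|lborel. of_real (levy_kernel s r) * (pairing u (heat t g) - pairing u (heat (t + r) g)))"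
  using levy_pairing_norm_power[OF good_symbols_heat[OF g t] s]
  unfolding multiplier_commute[of "\<lambda>l. l powr s"] heat_heat by (simp add: add.commute)

text \<open>
  The symbols \<open>g\<close> of functions \<open>w\<close> such that \<open>u\<close> annihilates \<open>((-\<Delta>)\<^sup>s - 1) exp (t \<Delta>) w\<close> for all times \<open>t\<close>
  of the heat flow. Keeping all times in the definition turns the equation into a relation between functions of
  \<open>t\<close> on the half-line, and it makes the set stable under fractional powers.
\<close>

definition solution_symbols :: "real \<Rightarrow> ('a \<Rightarrow> complex) set" where
  "solution_symbols s = {g \<in> good_symbols. \<forall>t\<ge>0. pairing u (heat t (norm_power s g)) = pairing u (heat t g)}"

lemma solution_symbolsD:
  assumes "g \<in> solution_symbols s"
  shows "g \<in> good_symbols" "\<And>t. 0 \<le> t \<Longrightarrow> pairing u (heat t (norm_power s g)) = pairing u (heat t g)"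
  using assms by (auto simp: solution_symbols_def)

lemma solution_symbols_heat:
  assumes g: "g \<in> solution_symbols s" and t: "0 \<le> t"
  shows "heat t g \<in> solution_symbols s"
  using solution_symbolsD[OF g] t
  by (auto simp: solution_symbols_def multiplier_commute[of "\<lambda>l. l powr s"] heat_heat good_symbols_heat)

lemma solution_symbols_norm_power:
  assumes g: "g \<in> solution_symbols s" and s: "0 < s" and \<sigma>: "0 < \<sigma>" "\<sigma> < 1"
  shows "norm_power \<sigma> g \<in> solution_symbols s"
proof -
  note gg = solution_symbolsD(1)[OF g]
  have "pairing u (heat t (norm_power s (norm_power \<sigma> g))) = pairing u (heat t (norm_power \<sigma> g))" if t: "0 \<le> t" for t
  proof -
    have "of_real (levy_constant \<sigma>) * pairing u (heat t (norm_power s (norm_power \<sigma> g)))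
        = (LINT r|lborel. of_real (levy_kernel \<sigma> r) *
            (pairing u (heat t (norm_power s g)) - pairing u (heat (t + r) (norm_power s g))))"
      unfolding multiplier_commute[of "\<lambda>l. l powr s" "\<lambda>l. l powr \<sigma>"]
      by (rule pairing_norm_power[OF good_symbols_norm_power_pos[OF gg s] \<sigma> t])
    also have "\<dots> = (LINT r|lborel. of_real (levy_kernel \<sigma> r) * (pairing u (heat t g) - pairing u (heat (t + r) g)))"
    proof (rule Bochner_Integration.integral_cong[OF refl])
      fix r
      show "of_real (levy_kernel \<sigma> r) *
            (pairing u (heat t (norm_power s g)) - pairing u (heat (t + r) (norm_power s g)))
          = of_real (levy_kernel \<sigma> r) * (pairing u (heat t g) - pairing u (heat (t + r) g))"
        using solution_symbolsD(2)[OF g] t by (cases "0 < r") (auto simp: levy_kernel_def)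
    qed
    also have "\<dots> = of_real (levy_constant \<sigma>) * pairing u (heat t (norm_power \<sigma> g))"
      by (rule pairing_norm_power[OF gg \<sigma> t, symmetric])
    finally show ?thesis using levy_constant_pos[OF \<sigma>] by simp
  qed
  then show ?thesis using good_symbols_norm_power[OF gg \<sigma>] by (simp add: solution_symbols_def)
qed

text \<open>
  Halving the exponent: \<open>l\<^sup>s - 1 = (l\<^sup>\<tau> + 1) (l\<^sup>\<tau> - 1)\<close> for \<open>\<tau> = s/2 \<le> 1\<close>, and \<open>(-\<Delta>)\<^sup>\<tau> + 1\<close> is injective in
  the relevant sense. Indeed the pairing \<open>d(t)\<close> with \<open>((-\<Delta>)\<^sup>\<tau> - 1) exp (t \<Delta>) w\<close>, where \<open>w\<close> has symbol \<open>g\<close>, satisfies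
  \<open>(-d/dt)\<^sup>\<tau> d = -d\<close>. For \<open>\<tau> < 1\<close> the maximum principle applies; for \<open>\<tau> = 1\<close> the equation is \<open>d' = d\<close>, which
  has no bounded solution but zero.
\<close>

lemma solution_symbols_half:
  assumes g: "g \<in> solution_symbols s" and s: "0 < s" "s \<le> 2"
  shows "g \<in> solution_symbols (s / 2)"
proof -
  note gg = solution_symbolsD(1)[OF g]
  define \<tau> where "\<tau> = s / 2"
  have \<tau>: "0 < \<tau>" "\<tau> \<le> 1" "\<tau> + \<tau> = s" using s by (auto simp: \<tau>_def)
  note g\<tau> = good_symbols_norm_power_pos[OF gg \<tau>(1)]
  define v where "v = (\<lambda>\<xi>. norm_power \<tau> g \<xi> - g \<xi>)"
  define d where "d t = pairing u (heat t v)" for t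
  have v: "v \<in> good_symbols" unfolding v_def by (intro good_symbols_diff g\<tau> gg)
  have d: "d t = pairing u (heat t (norm_power \<tau> g)) - pairing u (heat t g)" if "0 \<le> t" for t
    unfolding d_def v_def multiplier_diff by (intro pairing_diff good_symbols_heat g\<tau> gg that)
  have minus: "pairing u (heat t (norm_power \<tau> v)) = - d t" if t: "0 \<le> t" for t
  proof -
    have "pairing u (heat t (norm_power \<tau> v))
        = pairing u (heat t (norm_power \<tau> (norm_power \<tau> g))) - pairing u (heat t (norm_power \<tau> g))"
      unfolding v_def multiplier_diff
      by (intro pairing_diff good_symbols_heat good_symbols_norm_power_pos[OF g\<tau>] g\<tau> \<tau>(1) t)
    then show ?thesis using solution_symbolsD(2)[OF g t] d[OF t] by (simp add: norm_power_norm_power \<tau>(3))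
  qed
  note meas = borel_measurable_pairing_heat[OF v, folded d_def]
  note lip = pairing_heat_lipschitz[OF v, folded d_def]
  note bound = norm_pairing_heat[OF v, folded d_def]
  let ?M = "C * (LINT x|lborel. norm (inverse_fourier v x))"
  have "d t = 0" if t: "0 \<le> t" for t
  proof (cases "\<tau> < 1")
    case True
    show ?thesis
    proof (rule fractional_maximum_principle[OF \<tau>(1) True levy_constant_pos[OF \<tau>(1) True] meas bound lip _ t])
      fix t :: real assume t: "0 \<le> t"
      show "(LINT r|lborel. of_real (levy_kernel \<tau> r) * (d t - d (t + r))) = - of_real (levy_constant \<tau>) * d t"
        unfolding d_def pairing_norm_power[OF v \<tau>(1) True t, symmetric]
        using minus[OF t] by (simp add: d_def)
    qed
  next
    case False
    then have 1: "\<tau> = 1" using \<tau> by simp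
    have cont: "continuous_on {0..} d"
      unfolding d_def by (rule continuous_on_pairing_heat[OF v])
    have ode: "d r = d 0 + of_real 1 * (LINT \<tau>|lborel. of_real (indicator {0..r} \<tau>) * d \<tau>)" if r: "0 \<le> r" for r
    proof -
      have "d 0 - d r = (LINT \<tau>|lborel. of_real (indicator {0..r} \<tau>) * pairing u (heat \<tau> (norm_square v)))"
        using pairing_heat_difference[OF v r] by (simp add: d_def)
      also have "\<dots> = (LINT \<tau>|lborel. - (of_real (indicator {0..r} \<tau>) * d \<tau>))"
        by (intro Bochner_Integration.integral_cong)
           (use minus[unfolded 1 norm_power_1] in \<open>auto simp: indicator_def\<close>)
      finally show ?thesis by (simp add: algebra_simps)
    qed
    have e: "d r = d 0 * of_real (exp r)" if "0 \<le> r" for r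
      using linear_ode_unique[OF cont ode that] by simp
    have "d 0 = 0"
    proof (rule ccontr)
      assume d0: "d 0 \<noteq> 0"
      obtain n :: nat where n: "?M / norm (d 0) < real n" using reals_Archimedean2 by blast
      have "norm (d 0) * real n \<le> norm (d 0) * exp (real n)"
      proof (rule mult_left_mono)
        show "real n \<le> exp (real n)" using exp_ge_add_one_self[of "real n"] by linarith
      qed simp
      also have "\<dots> = norm (d (real n))" using e[of "real n"] by (simp add: norm_mult)
      also have "\<dots> \<le> ?M" by (rule bound) simp
      finally show False using n d0 by (simp add: divide_less_eq mult.commute)
    qed
    then show ?thesis using e[OF t] by simp
  qed
  then show ?thesis using d gg by (auto simp: solution_symbols_def \<tau>_def)
qed

text \<open>
  The deviation of the heat flow from the decay \<open>exp (-r)\<close> that it has for solutions of the Helmholtz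
  equation. In terms of it, the equation with exponent \<open>s < 1\<close> says that its integral against the
  Levy kernel vanishes.
\<close>

definition exp_defect :: "('a \<Rightarrow> complex) \<Rightarrow> real \<Rightarrow> complex" where
  "exp_defect g r = of_real (exp (- r)) * pairing u g - pairing u (heat r g)"

lemma borel_measurable_exp_defect: "g \<in> good_symbols \<Longrightarrow> exp_defect g \<in> borel_measurable borel"
  unfolding exp_defect_def[abs_def] using borel_measurable_pairing_heat[of g] by measurable

lemma norm_exp_defect:
  assumes g: "g \<in> good_symbols"
  obtains M where "\<And>r. 0 < r \<Longrightarrow> norm (exp_defect g r) \<le> M * min 1 r"
proof -
  let ?N = "C * (LINT x|lborel. norm (inverse_fourier g x))"
  let ?K = "C * (LINT x|lborel. norm (inverse_fourier (norm_square g) x))"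
  have nn: "0 \<le> ?N" "0 \<le> ?K" using C_nonneg by (auto intro!: mult_nonneg_nonneg integral_nonneg_AE)
  have N: "norm (pairing u g) \<le> ?N" by (rule norm_pairing[OF g])
  have "norm (exp_defect g r) \<le> (2 * ?N + ?K) * min 1 r" if r: "0 < r" for r
  proof (cases "r \<le> 1")
    case True
    have eq: "exp_defect g r = (pairing u g - pairing u (heat r g)) - of_real (1 - exp (- r)) * pairing u g"
      by (simp add: exp_defect_def algebra_simps)
    have "norm (exp_defect g r) \<le> norm (pairing u g - pairing u (heat r g)) + norm (of_real (1 - exp (- r)) * pairing u g)"
      unfolding eq by (rule norm_triangle_ineq4)
    also have "\<dots> \<le> ?K * r + r * ?N"
    proof (rule add_mono)
      show "norm (pairing u g - pairing u (heat r g)) \<le> ?K * r"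
        using pairing_heat_lipschitz[OF g, of 0 r] r by simp
      have "\<bar>1 - exp (- r)\<bar> \<le> r" using one_minus_exp_le_min[of r] r by simp
      then show "norm (of_real (1 - exp (- r)) * pairing u g) \<le> r * ?N"
        unfolding norm_mult norm_of_real using N r by (intro mult_mono) auto
    qed
    also have "\<dots> \<le> ?K * r + r * ?N + r * ?N"
      using nn r by (simp only: le_add_same_cancel1 mult_nonneg_nonneg less_imp_le)
    also have "\<dots> = (2 * ?N + ?K) * r" by (simp add: algebra_simps)
    finally show ?thesis using True by simp
  next
    case False
    have "norm (exp_defect g r) \<le> norm (of_real (exp (- r)) * pairing u g) + norm (pairing u (heat r g))"
      unfolding exp_defect_def by (rule norm_triangle_ineq4)
    also have "\<dots> \<le> 1 * ?N + ?N"
      unfolding norm_mult norm_of_real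
      using N r norm_pairing_heat[OF g, of r] by (intro add_mono mult_mono) auto
    also have "\<dots> \<le> 2 * ?N + ?K" using nn by simp
    finally show ?thesis using False by simp
  qed
  then show ?thesis using that by blast
qed

lemma pairing_norm_power_defect:
  assumes g: "g \<in> good_symbols" and s: "0 < s" "s < 1"
  shows "of_real (levy_constant s) * (pairing u (norm_power s g) - pairing u g)
    = (LINT r|lborel. levy_kernel s r *\<^sub>R exp_defect g r)"
proof -
  obtain M where M: "\<And>r. 0 < r \<Longrightarrow> norm (exp_defect g r) \<le> M * min 1 r"
    using norm_exp_defect[OF g] by blast
  have 1: "integrable lborel (\<lambda>r. levy_kernel s r *\<^sub>R exp_defect g r)"
    by (rule integrable_bounded_levy_kernel(1)[OF s borel_measurable_exp_defect[OF g] M])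
  have 2: "integrable lborel (\<lambda>r. of_real ((1 - exp (- r)) * levy_kernel s r) * pairing u g)"
    using integrable_exp_levy_kernel[OF s, of 1] by (intro integrable_mult_left integrable_of_real) simp
  have "of_real (levy_constant s) * pairing u (norm_power s g)
      = (LINT r|lborel. levy_kernel s r *\<^sub>R exp_defect g r + of_real ((1 - exp (- r)) * levy_kernel s r) * pairing u g)"
    unfolding levy_pairing_norm_power[OF g s]
    by (intro Bochner_Integration.integral_cong) (simp_all add: exp_defect_def scaleR_conv_of_real algebra_simps)
  also have "\<dots> = (LINT r|lborel. levy_kernel s r *\<^sub>R exp_defect g r) + of_real (levy_constant s) * pairing u g"
    unfolding Bochner_Integration.integral_add[OF 1 2]
    by (simp only: integral_mult_left_zero integral_complex_of_real levy_constant_def)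
  finally show ?thesis by (simp add: algebra_simps)
qed

text \<open>
  The kernels with exponents in a compact subinterval of \<open>(0, 1)\<close> are dominated by the sum of the two
  kernels at its ends, so the pairing depends continuously on the exponent.
\<close>

lemma pairing_norm_power_limit:
  assumes g: "g \<in> good_symbols" and \<sigma>: "\<And>k. \<sigma> k \<in> {1/4..3/4}" "\<sigma> \<longlonglongrightarrow> 1/2"
    and eq: "\<And>k. pairing u (norm_power (\<sigma> k) g) = pairing u g"
  shows "pairing u (norm_power (1/2) g) = pairing u g"
proof -
  note [measurable] = borel_measurable_exp_defect[OF g]
  obtain M where M: "\<And>r. 0 < r \<Longrightarrow> norm (exp_defect g r) \<le> M * min 1 r"
    using norm_exp_defect[OF g] by blast
  have "0 \<le> M" using order_trans[OF norm_ge_zero M[of 1]] by simp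
  let ?w = "\<lambda>r. M * (min 1 r * levy_kernel (1/4) r + min 1 r * levy_kernel (3/4) r)"
  have "(\<lambda>k. LINT r|lborel. levy_kernel (\<sigma> k) r *\<^sub>R exp_defect g r)
      \<longlonglongrightarrow> (LINT r|lborel. levy_kernel (1/2) r *\<^sub>R exp_defect g r)"
  proof (rule integral_dominated_convergence[where w = ?w])
    show "integrable lborel ?w"
      by (intro integrable_mult_right Bochner_Integration.integrable_add integrable_min_levy_kernel) auto
    show "AE r in lborel. (\<lambda>k. levy_kernel (\<sigma> k) r *\<^sub>R exp_defect g r) \<longlonglongrightarrow> levy_kernel (1/2) r *\<^sub>R exp_defect g r"
    proof (rule AE_I2)
      fix r :: real
      show "(\<lambda>k. levy_kernel (\<sigma> k) r *\<^sub>R exp_defect g r) \<longlonglongrightarrow> levy_kernel (1/2) r *\<^sub>R exp_defect g r"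
      proof (cases "0 < r")
        case True
        then show ?thesis unfolding levy_kernel_def by (intro tendsto_intros \<sigma>) auto
      qed (simp add: levy_kernel_def)
    qed
    show "AE r in lborel. norm (levy_kernel (\<sigma> k) r *\<^sub>R exp_defect g r) \<le> ?w r" for k
    proof (rule AE_I2)
      fix r :: real
      show "norm (levy_kernel (\<sigma> k) r *\<^sub>R exp_defect g r) \<le> ?w r"
      proof (cases "0 < r")
        case True
        have "levy_kernel (\<sigma> k) r \<le> levy_kernel (1/4) r + levy_kernel (3/4) r"
        proof (cases "r \<le> 1")
          case True
          have "r powr (- 1 - \<sigma> k) \<le> r powr (- 1 - 3/4)"
            by (rule powr_mono') (use \<sigma>(1)[of k] True \<open>0 < r\<close> in auto)
          then show ?thesis using \<open>0 < r\<close> by (simp add: levy_kernel_def add_increasing)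
        next
          case False
          have "r powr (- 1 - \<sigma> k) \<le> r powr (- 1 - 1/4)"
            by (rule powr_mono) (use \<sigma>(1)[of k] False in auto)
          then show ?thesis using \<open>0 < r\<close> by (simp add: levy_kernel_def add_increasing2)
        qed
        then have "levy_kernel (\<sigma> k) r * norm (exp_defect g r)
            \<le> (levy_kernel (1/4) r + levy_kernel (3/4) r) * (M * min 1 r)"
          by (intro mult_mono M True) auto
        then show ?thesis by (simp add: algebra_simps)
      qed (simp add: levy_kernel_def)
    qed
  qed measurable
  moreover have "(LINT r|lborel. levy_kernel (\<sigma> k) r *\<^sub>R exp_defect g r) = 0" for k
    using pairing_norm_power_defect[OF g, of "\<sigma> k"] \<sigma>(1)[of k] eq[of k] by simp
  ultimately have "(LINT r|lborel. levy_kernel (1/2) r *\<^sub>R exp_defect g r) = 0"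
    by (simp add: LIMSEQ_const_iff)
  then have "of_real (levy_constant (1/2)) * (pairing u (norm_power (1/2) g) - pairing u g) = 0"
    using pairing_norm_power_defect[OF g, of "1/2"] by simp
  moreover have "0 < levy_constant (1/2)" by (rule levy_constant_pos) auto
  ultimately show ?thesis by simp
qed

text \<open>
  \<open>(-\<Delta>)\<^sup>\<sigma>\<close> may be applied repeatedly because the set is stable under fractional powers.
\<close>

lemma solution_symbols_multiple:
  assumes g: "g \<in> solution_symbols \<sigma>" and \<sigma>: "0 < \<sigma>" "\<sigma> < 1"
  shows "g \<in> solution_symbols (real (Suc j) * \<sigma>)"
proof -
  have step: "norm_power (real (Suc j) * \<sigma>) g \<in> solution_symbols \<sigma> \<and>
     (\<forall>t\<ge>0. pairing u (heat t (norm_power (real (Suc j) * \<sigma>) g)) = pairing u (heat t g))"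
  proof (induction j)
    case 0
    show ?case using solution_symbols_norm_power[OF g \<sigma>(1) \<sigma>] solution_symbolsD(2)[OF g] by simp
  next
    case (Suc j)
    have eq: "norm_power (real (Suc (Suc j)) * \<sigma>) g = norm_power \<sigma> (norm_power (real (Suc j) * \<sigma>) g)"
      by (simp only: norm_power_norm_power) (simp add: algebra_simps)
    show ?case unfolding eq
      using Suc solution_symbols_norm_power[OF _ \<sigma>(1) \<sigma>] solution_symbolsD(2) by metis
  qed
  then show ?thesis using solution_symbolsD(1)[OF g] by (simp add: solution_symbols_def)
qed

text \<open>
  Repeated halving gives the equation for the exponents \<open>s / 2\<^sup>k\<close>, hence for their integer multiples.
  These accumulate at \<open>1/2\<close>, where the equation holds by continuity; doubling gives the exponent \<open>1\<close>.
  The detour through \<open>1/2\<close> stays in the range \<open>s < 1\<close> of the integral representation.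
\<close>

lemma solution_symbols_imp_helmholtz:
  assumes g: "g \<in> solution_symbols s" and s: "0 < s" "s \<le> 2"
  shows "g \<in> solution_symbols 1"
proof -
  \<comment> \<open>Starting at \<open>s / 8 \<le> 1/4\<close> ensures that the multiples chosen below lie in \<open>{1/4..1/2}\<close>.\<close>
  define \<sigma> where "\<sigma> k = s / 2 ^ (k + 3)" for k :: nat
  have \<sigma>: "0 < \<sigma> k" "\<sigma> k \<le> 1/4" "\<sigma> k < 1" for k
  proof -
    have "s / 2 ^ (k + 3) \<le> 2 / 2 ^ (k + 3)" using s by (intro divide_right_mono) auto
    also have "\<dots> \<le> 2 / 2 ^ 3" by (intro divide_left_mono power_increasing) auto
    finally show "\<sigma> k \<le> 1/4" by (simp add: \<sigma>_def)
    then show "\<sigma> k < 1" by simp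
  qed (use s in \<open>simp add: \<sigma>_def\<close>)
  have "g \<in> solution_symbols (s / 2 ^ k)" for k
  proof (induction k)
    case (Suc k)
    have "s / 2 ^ k \<le> s / 1" using s by (intro divide_left_mono) auto
    then show ?case using solution_symbols_half[OF Suc] s by (simp add: mult.commute)
  qed (use g in simp)
  then have g\<sigma>: "g \<in> solution_symbols (\<sigma> k)" for k unfolding \<sigma>_def .
  \<comment> \<open>The multiple of \<open>\<sigma> k\<close> closest to \<open>1/2\<close> from below; its factor is \<open>Suc (j k)\<close>.\<close>
  define j where "j k = nat \<lfloor>1 / (2 * \<sigma> k)\<rfloor> - 1" for k
  have fl: "2 \<le> \<lfloor>1 / (2 * \<sigma> k)\<rfloor>" for k
  proof -
    have "2 \<le> 1 / (2 * \<sigma> k)" using \<sigma>[of k] by (simp add: field_simps)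
    then show ?thesis by (simp add: le_floor_iff)
  qed
  have Sj: "real (Suc (j k)) = of_int \<lfloor>1 / (2 * \<sigma> k)\<rfloor>" for k
  proof -
    have "Suc (j k) = nat \<lfloor>1 / (2 * \<sigma> k)\<rfloor>" unfolding j_def using fl[of k] by linarith
    moreover have "0 \<le> \<lfloor>1 / (2 * \<sigma> k)\<rfloor>" using fl[of k] by linarith
    ultimately show ?thesis by (simp only: of_nat_nat)
  qed
  define \<rho> where "\<rho> k = real (Suc (j k)) * \<sigma> k" for k
  have \<rho>: "\<rho> k \<le> 1/2" "1/2 - \<sigma> k \<le> \<rho> k" for k
  proof -
    have "of_int \<lfloor>1 / (2 * \<sigma> k)\<rfloor> * \<sigma> k \<le> 1 / (2 * \<sigma> k) * \<sigma> k"
      using \<sigma>[of k] by (intro mult_right_mono) auto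
    then show "\<rho> k \<le> 1/2" unfolding \<rho>_def Sj using \<sigma>[of k] by simp
    have "(1 / (2 * \<sigma> k) - 1) * \<sigma> k \<le> of_int \<lfloor>1 / (2 * \<sigma> k)\<rfloor> * \<sigma> k"
      using \<sigma>[of k] by (intro mult_right_mono) linarith+
    then show "1/2 - \<sigma> k \<le> \<rho> k" unfolding \<rho>_def Sj using \<sigma>[of k] by (simp add: left_diff_distrib)
  qed
  have "(\<lambda>k. 1/2 - \<sigma> k) \<longlonglongrightarrow> 1/2 - 0"
  proof (intro tendsto_intros)
    have "(\<lambda>k. s / 8 * (1/2) ^ k) \<longlonglongrightarrow> s / 8 * 0" by (intro tendsto_intros LIMSEQ_power_zero) auto
    then show "\<sigma> \<longlonglongrightarrow> 0" by (simp add: \<sigma>_def[abs_def] power_add power_one_over field_simps)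
  qed
  then have lower: "(\<lambda>k. 1/2 - \<sigma> k) \<longlonglongrightarrow> 1/2" by simp
  have \<rho>lim: "\<rho> \<longlonglongrightarrow> 1/2"
    by (rule real_tendsto_sandwich[OF _ _ lower tendsto_const]) (use \<rho> in \<open>auto intro!: always_eventually\<close>)
  have \<rho>14: "\<rho> k \<in> {1/4..3/4}" for k using \<rho>[of k] \<sigma>[of k] by auto
  have half: "g \<in> solution_symbols (1/2)"
  proof -
    have "pairing u (heat t (norm_power (1/2) g)) = pairing u (heat t g)" if t: "0 \<le> t" for t
    proof -
      have "pairing u (norm_power (\<rho> k) (heat t g)) = pairing u (heat t g)" for k
        using solution_symbolsD(2)[OF solution_symbols_multiple[OF g\<sigma> \<sigma>(1,3)] t, of "j k" k]
        by (simp only: \<rho>_def multiplier_commute[of "\<lambda>l. l powr _"])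
      from pairing_norm_power_limit[OF good_symbols_heat[OF solution_symbolsD(1)[OF g] t] \<rho>14 \<rho>lim this]
      show ?thesis by (simp only: multiplier_commute[of "\<lambda>l. l powr _"])
    qed
    then show ?thesis using solution_symbolsD(1)[OF g] by (simp add: solution_symbols_def)
  qed
  show ?thesis using solution_symbols_multiple[OF half, of 1] by simp
qed

text \<open>
  For exponent \<open>1\<close> the heat equation becomes \<open>d' = -d\<close>, so the heat flow decays like \<open>exp (-t)\<close> and the
  defect vanishes; this settles \<open>s < 1\<close>. Larger exponents are reached by applying \<open>-\<Delta>\<close> first.
\<close>

lemma helmholtz_imp_solution_symbols:
  assumes g: "g \<in> solution_symbols 1" and s: "0 < s" "s \<le> 2"
  shows "g \<in> solution_symbols s"
proof -
  have decay: "pairing u (heat r g) = of_real (exp (- r)) * pairing u g" if g: "g \<in> solution_symbols 1" and r: "0 \<le> r" for g r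
  proof -
    note gg = solution_symbolsD(1)[OF g]
    define d where "d t = pairing u (heat t g)" for t
    have cont: "continuous_on {0..} d"
      unfolding d_def by (rule continuous_on_pairing_heat[OF gg])
    have ode: "d r = d 0 + of_real (- 1) * (LINT \<tau>|lborel. of_real (indicator {0..r} \<tau>) * d \<tau>)" if r: "0 \<le> r" for r
    proof -
      have "d 0 - d r = (LINT \<tau>|lborel. of_real (indicator {0..r} \<tau>) * pairing u (heat \<tau> (norm_square g)))"
        using pairing_heat_difference[OF gg r] by (simp add: d_def)
      also have "\<dots> = (LINT \<tau>|lborel. of_real (indicator {0..r} \<tau>) * d \<tau>)"
        by (intro Bochner_Integration.integral_cong)
           (use solution_symbolsD(2)[OF g, unfolded norm_power_1] in \<open>auto simp: indicator_def d_def\<close>)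
      finally show ?thesis by (simp add: algebra_simps)
    qed
    from linear_ode_unique[OF cont ode r] show ?thesis by (simp add: d_def mult.commute)
  qed
  have small: "g \<in> solution_symbols \<sigma>" if g: "g \<in> solution_symbols 1" and \<sigma>: "0 < \<sigma>" "\<sigma> < 1" for g \<sigma>
  proof -
    have "pairing u (norm_power \<sigma> h) = pairing u h" if h: "h \<in> solution_symbols 1" for h
    proof -
      have z: "levy_kernel \<sigma> r *\<^sub>R exp_defect h r = 0" for r
        using decay[OF h, of r] by (cases "0 < r") (auto simp: exp_defect_def levy_kernel_def)
      show ?thesis
        using pairing_norm_power_defect[OF solution_symbolsD(1)[OF h] \<sigma>] levy_constant_pos[OF \<sigma>] unfolding z by simp
    qed
    from this[OF solution_symbols_heat[OF g]]
    have "pairing u (norm_power \<sigma> (heat t g)) = pairing u (heat t g)" if "0 \<le> t" for t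
      using that by blast
    then have "pairing u (heat t (norm_power \<sigma> g)) = pairing u (heat t g)" if "0 \<le> t" for t
      using that by (simp only: multiplier_commute[of "\<lambda>l. l powr \<sigma>"])
    then show ?thesis using solution_symbolsD(1)[OF g] by (simp add: solution_symbols_def)
  qed
  consider "s < 1" | "s = 1" | "1 < s" by linarith
  then show ?thesis
  proof cases
    case 1
    then show ?thesis using small g s by blast
  next
    case 2
    then show ?thesis using g by simp
  next
    case 3
    have "norm_power (1/2) (norm_power (1/2) g) \<in> solution_symbols 1"
      by (intro solution_symbols_norm_power g) auto
    then have n: "norm_power 1 g \<in> solution_symbols 1" by (simp add: norm_power_norm_power)
    have "norm_power 1 g \<in> solution_symbols (s - 1)"
      using small[OF n, of "s - 1"] n 3 s by (cases "s = 2") auto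
    from solution_symbolsD(2)[OF this]
    have "pairing u (heat t (norm_power s g)) = pairing u (heat t (norm_power 1 g))" if "0 \<le> t" for t
      using that unfolding norm_power_norm_power by simp
    then have "pairing u (heat t (norm_power s g)) = pairing u (heat t g)" if "0 \<le> t" for t
      using that solution_symbolsD(2)[OF g that] by (simp only:)
    then show ?thesis using solution_symbolsD(1)[OF g] by (simp add: solution_symbols_def)
  qed
qed

end

section \<open>Fourier transforms of test functions\<close>

lemma fourier_measurable [measurable]:
  assumes [measurable]: "f \<in> borel_measurable borel"
  shows "fourier f \<in> borel_measurable borel"
  unfolding fourier_def[abs_def] by measurable

lemma norm_fourier_le: "norm (fourier f \<xi>) \<le> (LINT x|lborel. norm (f x))"
  unfolding fourier_def by (rule order_trans[OF integral_norm_bound]) (simp add: norm_mult)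

lemma test_function_borel_measurable [measurable_dest]: "test_function f \<Longrightarrow> f \<in> borel_measurable borel"
  by (simp add: test_function_iff smooth_imp_borel_measurable)

lemma test_function_minus_laplacian:
  assumes "test_function f"
  shows "test_function (\<lambda>x. f x - laplacian f x)"
proof -
  have l: "test_function (\<lambda>x. - laplacian f x)"
    by (intro test_function_uminus test_function_laplacian assms)
  obtain R R' where R: "\<And>x. R < norm x \<Longrightarrow> f x = 0" "\<And>x. R' < norm x \<Longrightarrow> - laplacian f x = 0"
    using assms l unfolding test_function_iff by blast
  then have "\<forall>x. max R R' < norm x \<longrightarrow> f x - laplacian f x = 0" by simp
  moreover have "smooth (\<lambda>x. f x + - laplacian f x)"
    using assms l by (intro smooth_add) (simp_all only: test_function_iff)
  then have "smooth (\<lambda>x. f x - laplacian f x)" by simp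
  ultimately show ?thesis unfolding test_function_iff by blast
qed

lemma fourier_minus_laplacian:
  assumes "test_function f"
  shows "fourier (\<lambda>x. f x - laplacian f x) \<xi> = of_real (1 + (norm \<xi>)\<^sup>2) * fourier f \<xi>"
proof -
  have i: "integrable lborel (\<lambda>x. h x * cis (- (x \<bullet> \<xi>)))" if "test_function h" for h
    using integrable_times_cis[OF test_function_integrable[OF that], of "- \<xi>"] by (simp add: inner_commute)
  have l: "test_function (\<lambda>x. - laplacian f x)"
    by (intro test_function_uminus test_function_laplacian assms)
  have "fourier (\<lambda>x. f x - laplacian f x) \<xi> = fourier f \<xi> + fourier (\<lambda>x. - laplacian f x) \<xi>"
    unfolding fourier_def by (subst Bochner_Integration.integral_add[OF i[OF assms] i[OF l], symmetric])
      (simp add: algebra_simps)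
  then show ?thesis by (simp add: fourier_neg_laplacian[OF assms] distrib_right)
qed

text \<open>
  Applying \<open>1 - \<Delta>\<close> sufficiently often to \<open>f\<close> shows that the transform decays like an integrable power
  of \<open>1 + |\<xi>|\<^sup>2\<close>.
\<close>

lemma integrable_fourier:
  fixes f :: "'a::euclidean_space \<Rightarrow> complex"
  assumes f: "test_function f"
  shows "integrable lborel (fourier f)"
proof -
  have "\<exists>h. test_function h \<and> (\<forall>\<xi>. fourier h \<xi> = of_real ((1 + (norm \<xi>)\<^sup>2) ^ n) * fourier f \<xi>)" for n
  proof (induction n)
    case 0
    show ?case using f by auto
  next
    case (Suc n)
    then obtain h where h: "test_function h" "\<And>\<xi>. fourier h \<xi> = of_real ((1 + (norm \<xi>)\<^sup>2) ^ n) * fourier f \<xi>"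
      by blast
    show ?case
      by (intro exI[of _ "\<lambda>x. h x - laplacian h x"] conjI test_function_minus_laplacian h allI)
         (simp add: fourier_minus_laplacian h mult.assoc)
  qed
  then obtain h where h: "test_function h"
      "\<And>\<xi>. fourier h \<xi> = of_real ((1 + (norm \<xi>)\<^sup>2) ^ DIM('a)) * fourier f \<xi>"
    by blast
  let ?N = "LINT x|lborel. norm (h x)"
  note [measurable] = test_function_borel_measurable[OF f]
  show ?thesis
  proof (rule Bochner_Integration.integrable_bound)
    show "integrable lborel (\<lambda>\<xi>::'a. ?N * inverse ((1 + (norm \<xi>)\<^sup>2) ^ DIM('a)))"
      by (intro integrable_mult_right integrable_bessel_weight)
    show "AE \<xi> in lborel. norm (fourier f \<xi>) \<le> norm (?N * inverse ((1 + (norm \<xi>)\<^sup>2) ^ DIM('a)))"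
    proof (rule AE_I2)
      fix \<xi> :: 'a
      have p: "0 < (1 + (norm \<xi>)\<^sup>2) ^ DIM('a)" by (simp add: add_pos_nonneg)
      have "(1 + (norm \<xi>)\<^sup>2) ^ DIM('a) * norm (fourier f \<xi>) = norm (fourier h \<xi>)"
        unfolding h(2) norm_mult norm_of_real using p by simp
      also have "\<dots> \<le> ?N" by (rule norm_fourier_le)
      finally have "norm (fourier f \<xi>) \<le> ?N * inverse ((1 + (norm \<xi>)\<^sup>2) ^ DIM('a))"
        using p by (simp add: field_simps)
      then show "norm (fourier f \<xi>) \<le> norm (?N * inverse ((1 + (norm \<xi>)\<^sup>2) ^ DIM('a)))"
        by (rule order_trans) (simp only: real_norm_def abs_ge_self)
    qed
  qed measurable
qed

text \<open>
  The Gaussian is its own Fourier transform up to scaling. Inserting this for the weight on the left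
  and exchanging the integrals gives a regularised Fourier inversion formula.
\<close>

lemma gaussian_mean_fourier:
  fixes f :: "'a::euclidean_space \<Rightarrow> complex"
  assumes f: "test_function f" and e: "0 < e"
  shows "(LINT z|lborel. of_real (gauss z) * f (x - e *\<^sub>R z))
    = of_real (gauss (0::'a)) * (LINT \<xi>|lborel. of_real (gauss (e *\<^sub>R \<xi>)) * (fourier f \<xi> * cis (x \<bullet> \<xi>)))"
proof -
  note fi = test_function_integrable[OF f]
  note [measurable] = test_function_borel_measurable[OF f]
  let ?h = "\<lambda>z \<eta>. of_real (gauss \<eta>) * (f (x - e *\<^sub>R z) * cis (z \<bullet> \<eta>))"
  have fa: "integrable lborel (\<lambda>z. f (x - e *\<^sub>R z))"
    using lborel_integrable_affine[of "- e" f x] fi e by simp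
  have gauss0: "gauss z = gauss (0::'a) * exp (- (norm z)\<^sup>2 / 2)" for z :: 'a
    by (simp add: gauss_eq)
  have swap: "(LINT z|lborel. LINT \<eta>|lborel. ?h z \<eta>) = (LINT \<eta>|lborel. LINT z|lborel. ?h z \<eta>)"
  proof (rule fubini_swap[where B = "\<lambda>\<eta>. gauss \<eta> * (LINT z|lborel. norm (f (x - e *\<^sub>R z)))"])
    show "(\<lambda>(z, \<eta>). ?h z \<eta>) \<in> borel_measurable (borel \<Otimes>\<^sub>M borel)" by measurable
    show "integrable lborel (\<lambda>z. ?h z \<eta>)" for \<eta>
      using integrable_times_cis[OF fa, of \<eta>] by (intro integrable_mult_right) (simp add: inner_commute)
    show "(LINT z|lborel. norm (?h z \<eta>)) \<le> gauss \<eta> * (LINT z|lborel. norm (f (x - e *\<^sub>R z)))" for \<eta>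
      by (simp add: norm_mult)
    show "integrable lborel (\<lambda>\<eta>. gauss \<eta> * (LINT z|lborel. norm (f (x - e *\<^sub>R z))))"
      by (intro integrable_mult_left integrable_gauss)
  qed
  have 1: "(LINT \<eta>|lborel. ?h z \<eta>) = f (x - e *\<^sub>R z) * of_real (exp (- (norm z)\<^sup>2 / 2))" for z
  proof -
    have "(LINT \<eta>|lborel. ?h z \<eta>) = (LINT \<eta>|lborel. f (x - e *\<^sub>R z) * (of_real (gauss \<eta>) * cis (\<eta> \<bullet> z)))"
      by (simp add: mult.left_commute inner_commute)
    then show ?thesis by (simp only: integral_mult_right_zero integral_gauss_cis)
  qed
  have 2: "of_real (e ^ DIM('a)) * (LINT z|lborel. f (x - e *\<^sub>R z) * cis (z \<bullet> \<eta>))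
      = fourier f (\<eta> /\<^sub>R e) * cis (x \<bullet> (\<eta> /\<^sub>R e))" for \<eta>
  proof -
    have "(LINT y|lborel. f y * cis ((x - y) \<bullet> (\<eta> /\<^sub>R e)))
        = \<bar>- e\<bar> ^ DIM('a) *\<^sub>R (LINT z|lborel. f (x + (- e) *\<^sub>R z) * cis ((x - (x + (- e) *\<^sub>R z)) \<bullet> (\<eta> /\<^sub>R e)))"
    proof (rule lborel_integral_affine)
      show "integrable lborel (\<lambda>y. f y * cis ((x - y) \<bullet> (\<eta> /\<^sub>R e)))"
        by (rule Bochner_Integration.integrable_bound[OF fi]) (auto simp: norm_mult)
    qed (use e in simp)
    also have "\<dots> = of_real (e ^ DIM('a)) * (LINT z|lborel. f (x - e *\<^sub>R z) * cis (z \<bullet> \<eta>))"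
      using e by (simp add: scaleR_conv_of_real mult.assoc[symmetric, of "inverse e"])
    also have "(LINT y|lborel. f y * cis ((x - y) \<bullet> (\<eta> /\<^sub>R e)))
        = (LINT y|lborel. f y * cis (- (y \<bullet> (\<eta> /\<^sub>R e))) * cis (x \<bullet> (\<eta> /\<^sub>R e)))"
      by (intro Bochner_Integration.integral_cong) (simp_all only: mult.assoc cis_mult inner_diff_left, simp)
    finally show ?thesis by (simp add: fourier_def)
  qed
  let ?F = "\<lambda>\<eta>. of_real (gauss \<eta>) * (fourier f (\<eta> /\<^sub>R e) * cis (x \<bullet> (\<eta> /\<^sub>R e)))"
  have Fi: "integrable lborel ?F"
  proof (rule Bochner_Integration.integrable_bound)
    show "integrable lborel (\<lambda>\<eta>::'a. gauss \<eta> * (LINT x|lborel. norm (f x)))"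
      by (intro integrable_mult_left integrable_gauss)
    show "AE \<eta> in lborel. norm (?F \<eta>) \<le> norm (gauss \<eta> * (LINT x|lborel. norm (f x)))"
      by (rule AE_I2) (auto simp: norm_mult integral_nonneg_AE intro!: mult_left_mono norm_fourier_le)
  qed measurable
  have "of_real (e ^ DIM('a)) * (LINT z|lborel. of_real (gauss z) * f (x - e *\<^sub>R z))
      = of_real (gauss (0::'a)) * (of_real (e ^ DIM('a)) * (LINT z|lborel. LINT \<eta>|lborel. ?h z \<eta>))"
    unfolding 1 by (subst gauss0) (simp add: mult.assoc mult.left_commute mult.commute)
  also have "of_real (e ^ DIM('a)) * (LINT z|lborel. LINT \<eta>|lborel. ?h z \<eta>) = (LINT \<eta>|lborel. ?F \<eta>)"
    unfolding swap integral_mult_right_zero[symmetric] 2[symmetric]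
    by (simp only: integral_mult_right_zero mult.left_commute)
  also have "\<dots> = \<bar>e\<bar> ^ DIM('a) *\<^sub>R (LINT \<xi>|lborel. ?F (0 + e *\<^sub>R \<xi>))"
    by (rule lborel_integral_affine) (use e Fi in auto)
  also have "\<dots> = of_real (e ^ DIM('a)) * (LINT \<xi>|lborel. of_real (gauss (e *\<^sub>R \<xi>)) * (fourier f \<xi> * cis (x \<bullet> \<xi>)))"
    using e by (simp add: scaleR_conv_of_real)
  finally show ?thesis using e by (simp add: mult.left_commute)
qed

text \<open>
  Both sides of the regularised formula converge as \<open>e\<close> tends to zero: the left-hand side by
  continuity of \<open>f\<close>, the right-hand side by integrability of its transform.
\<close>

lemma inverse_fourier_fourier:
  fixes f :: "'a::euclidean_space \<Rightarrow> complex"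
  assumes f: "test_function f"
  shows "inverse_fourier (fourier f) = f"
proof
  fix x
  note [measurable] = test_function_borel_measurable[OF f]
  define e where "e n = inverse (real (Suc n))" for n
  have e: "0 < e n" for n by (simp add: e_def)
  have e0: "e \<longlonglongrightarrow> 0" unfolding e_def by (rule LIMSEQ_inverse_real_of_nat)
  obtain M where M: "\<And>x. norm (f x) \<le> M" using test_function_bounded[OF f] by blast
  have cont: "isCont f y" for y
    using f by (auto simp: test_function_iff intro!: differentiable_imp_continuous_within smooth_imp_differentiable)
  have "(\<lambda>n. LINT z|lborel. of_real (gauss z) * f (x - e n *\<^sub>R z)) \<longlonglongrightarrow> (LINT z::'a|lborel. of_real (gauss z) * f x)"
  proof (rule integral_dominated_convergence[where w = "\<lambda>z. gauss z * M"])
    show "integrable lborel (\<lambda>z::'a. gauss z * M)" by (intro integrable_mult_left integrable_gauss)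
    show "AE z in lborel. (\<lambda>n. of_real (gauss z) * f (x - e n *\<^sub>R z)) \<longlonglongrightarrow> of_real (gauss z) * f x"
    proof (rule AE_I2)
      fix z
      have "(\<lambda>n. x - e n *\<^sub>R z) \<longlonglongrightarrow> x - 0 *\<^sub>R z" by (intro tendsto_intros e0)
      then have "(\<lambda>n. f (x - e n *\<^sub>R z)) \<longlonglongrightarrow> f x"
        using isCont_tendsto_compose[OF cont, of "\<lambda>n. x - e n *\<^sub>R z"] by simp
      then show "(\<lambda>n. of_real (gauss z) * f (x - e n *\<^sub>R z)) \<longlonglongrightarrow> of_real (gauss z) * f x"
        by (intro tendsto_intros)
    qed
    show "AE z in lborel. norm (of_real (gauss z) * f (x - e n *\<^sub>R z)) \<le> gauss z * M" for n
      by (rule AE_I2) (auto simp: norm_mult intro!: mult_left_mono M)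
  qed measurable
  moreover have "(LINT z::'a|lborel. of_real (gauss z) * f x) = f x"
    using integral_gauss[where 'a = 'a] by simp
  moreover have "(\<lambda>n. of_real (gauss (0::'a)) * (LINT \<xi>|lborel. of_real (gauss (e n *\<^sub>R \<xi>)) * (fourier f \<xi> * cis (x \<bullet> \<xi>))))
      \<longlonglongrightarrow> of_real (gauss (0::'a)) * (LINT \<xi>|lborel. of_real (gauss (0::'a)) * (fourier f \<xi> * cis (x \<bullet> \<xi>)))"
  proof (intro tendsto_mult tendsto_const, rule integral_dominated_convergence[where w = "\<lambda>\<xi>. gauss (0::'a) * norm (fourier f \<xi>)"])
    show "integrable lborel (\<lambda>\<xi>. gauss (0::'a) * norm (fourier f \<xi>))"
      by (intro integrable_mult_right integrable_norm integrable_fourier f)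
    show "AE \<xi> in lborel. (\<lambda>n. complex_of_real (gauss (e n *\<^sub>R \<xi>)) * (fourier f \<xi> * cis (x \<bullet> \<xi>)))
        \<longlonglongrightarrow> of_real (gauss (0::'a)) * (fourier f \<xi> * cis (x \<bullet> \<xi>))"
    proof (rule AE_I2)
      fix \<xi> :: 'a
      have "(\<lambda>n. e n *\<^sub>R \<xi>) \<longlonglongrightarrow> 0 *\<^sub>R \<xi>" by (intro tendsto_intros e0)
      moreover have "isCont gauss (0 *\<^sub>R \<xi>)"
      proof -
        have "continuous_on UNIV (gauss :: 'a \<Rightarrow> real)" by (intro continuous_intros)
        then show ?thesis by (simp add: continuous_on_eq_continuous_at)
      qed
      ultimately have "(\<lambda>n. gauss (e n *\<^sub>R \<xi>)) \<longlonglongrightarrow> gauss (0::'a)"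
        using isCont_tendsto_compose by fastforce
      then show "(\<lambda>n. complex_of_real (gauss (e n *\<^sub>R \<xi>)) * (fourier f \<xi> * cis (x \<bullet> \<xi>)))
        \<longlonglongrightarrow> of_real (gauss (0::'a)) * (fourier f \<xi> * cis (x \<bullet> \<xi>))" by (intro tendsto_intros)
    qed
    have "gauss \<eta> \<le> gauss (0::'a)" for \<eta> :: 'a by (simp add: gauss_eq divide_right_mono)
    then show "AE \<xi> in lborel. norm (of_real (gauss (e n *\<^sub>R \<xi>)) * (fourier f \<xi> * cis (x \<bullet> \<xi>)))
        \<le> gauss (0::'a) * norm (fourier f \<xi>)" for n
      by (intro AE_I2) (auto simp: norm_mult intro!: mult_right_mono)
  qed measurable
  ultimately have "f x = of_real (gauss (0::'a)) * (LINT \<xi>|lborel. of_real (gauss (0::'a)) * (fourier f \<xi> * cis (x \<bullet> \<xi>)))"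
    unfolding gaussian_mean_fourier[OF f e] using LIMSEQ_unique by fastforce
  also have "\<dots> = of_real (gauss (0::'a) * gauss (0::'a)) * (LINT \<xi>|lborel. fourier f \<xi> * cis (x \<bullet> \<xi>))"
    by (simp add: mult.assoc)
  also have "gauss (0::'a) * gauss (0::'a) = 1 / (2 * pi) ^ DIM('a)"
  proof -
    have "sqrt (2 * pi) ^ DIM('a) * sqrt (2 * pi) ^ DIM('a) = (2 * pi) ^ DIM('a)"
      by (subst power_mult_distrib[symmetric]) (subst real_sqrt_mult_self, simp)
    then show ?thesis by (simp only: gauss_eq times_divide_times_eq) simp
  qed
  finally show "inverse_fourier (fourier f) x = f x"
    by (simp add: inverse_fourier_def)
qed

lemma fourier_good_symbols:
  assumes f: "test_function f"
  shows "fourier f \<in> good_symbols"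
  unfolding good_symbols_def mem_Collect_eq
proof (intro conjI allI)
  note [measurable] = test_function_borel_measurable[OF f]
  show "fourier f \<in> borel_measurable borel" by measurable
  fix k
  have "\<exists>h. test_function h \<and> multiplier (\<lambda>l. l ^ k) (fourier f) = fourier h"
  proof (induction k)
    case 0
    show ?case using f by auto
  next
    case (Suc k)
    then obtain h where h: "test_function h" "multiplier (\<lambda>l. l ^ k) (fourier f) = fourier h" by blast
    have "multiplier (\<lambda>l. l ^ Suc k) (fourier f) = norm_square (fourier h)"
      by (simp add: h(2)[symmetric] multiplier_multiplier)
    also have "\<dots> = fourier (\<lambda>x. - laplacian h x)"
      by (rule ext) (simp add: multiplier_def fourier_neg_laplacian[OF h(1)])
    finally show ?case using test_function_uminus[OF test_function_laplacian[OF h(1)]] by blast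
  qed
  then obtain h where h: "test_function h" "multiplier (\<lambda>l. l ^ k) (fourier f) = fourier h" by blast
  show "integrable lborel (multiplier (\<lambda>l. l ^ k) (fourier f))"
    unfolding h(2) by (rule integrable_fourier[OF h(1)])
  show "integrable lborel (inverse_fourier (multiplier (\<lambda>l. l ^ k) (fourier f)))"
    unfolding h(2) inverse_fourier_fourier[OF h(1)] by (rule test_function_integrable[OF h(1)])
qed

section \<open>Solutions of the fractional and the classical equation\<close>

lemma fourier_translate:
  fixes f :: "'a::euclidean_space \<Rightarrow> complex"
  assumes f: "integrable lborel f"
  shows "fourier (\<lambda>x. f (x - a)) = (\<lambda>\<xi>. fourier f \<xi> * cis (- (a \<bullet> \<xi>)))"
proof
  fix \<xi>
  have "integrable lborel (\<lambda>x. f (x - a))"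
    using lborel_integrable_affine[of 1 f "- a"] f by simp
  from integrable_times_cis[OF this, of "- \<xi>"]
  have "integrable lborel (\<lambda>x. f (x - a) * cis (- (x \<bullet> \<xi>)))" by (simp add: inner_commute)
  from lborel_integral_affine[OF _ this, of 1 a]
  have "fourier (\<lambda>x. f (x - a)) \<xi> = (LINT x|lborel. f x * cis (- (x \<bullet> \<xi>)) * cis (- (a \<bullet> \<xi>)))"
    by (simp add: fourier_def mult.assoc cis_mult inner_add_left algebra_simps)
  then show "fourier (\<lambda>x. f (x - a)) \<xi> = fourier f \<xi> * cis (- (a \<bullet> \<xi>))"
    by (simp add: fourier_def)
qed

lemma inverse_fourier_multiplier_translate:
  fixes f :: "'a::euclidean_space \<Rightarrow> complex"
  assumes f: "integrable lborel f"
  shows "inverse_fourier (multiplier h (fourier (\<lambda>x. f (x - a)))) x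
    = inverse_fourier (multiplier h (fourier f)) (x - a)"
proof -
  have "multiplier h (fourier (\<lambda>x. f (x - a))) = (\<lambda>\<xi>. multiplier h (fourier f) \<xi> * cis (- (a \<bullet> \<xi>)))"
    by (simp add: fourier_translate[OF f] multiplier_def fun_eq_iff mult.assoc)
  then show ?thesis by (simp add: inverse_fourier_translate)
qed

lemma frac_laplacian_test_eq: "frac_laplacian_test s f = inverse_fourier (norm_power s (fourier f))"
proof -
  have "norm \<xi> powr (2 * s) = ((norm \<xi>)\<^sup>2) powr s" for \<xi> :: 'a
    by (cases "\<xi> = 0") (simp_all add: powr_powr flip: powr_numeral)
  then show ?thesis by (simp add: frac_laplacian_test_def multiplier_def[abs_def])
qed

context bounded_function
begin

lemma frac_laplacian_eq_pairing: "frac_laplacian s u f = pairing u (norm_power s (fourier f))"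
  by (simp add: frac_laplacian_def frac_laplacian_test_eq pairing_def)

lemma distribution_of_eq_pairing: "test_function f \<Longrightarrow> distribution_of u f = pairing u (fourier f)"
  by (simp add: distribution_of_def pairing_def inverse_fourier_fourier)

text \<open>
  The equation tested with \<open>f\<close> is the case \<open>t = 0\<close>. The heat flow of \<open>f\<close> is no test function, but it is
  an average of translates of \<open>f\<close>, to which the equation applies.
\<close>

lemma solves_frac_helmholtz_iff:
  assumes s: "0 < s"
  shows "solves_frac_helmholtz s u \<longleftrightarrow> (\<forall>f. test_function f \<longrightarrow> fourier f \<in> solution_symbols s)"
proof
  assume "\<forall>f. test_function f \<longrightarrow> fourier f \<in> solution_symbols s"
  then show "solves_frac_helmholtz s u"
    using solution_symbolsD(2)[of _ s 0]
    by (simp add: solves_frac_helmholtz_def frac_laplacian_eq_pairing distribution_of_eq_pairing)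
next
  assume *: "solves_frac_helmholtz s u"
  show "\<forall>f. test_function f \<longrightarrow> fourier f \<in> solution_symbols s"
  proof (intro allI impI)
    fix f :: "'a \<Rightarrow> complex" assume f: "test_function f"
    note g = fourier_good_symbols[OF f]
    note gs = good_symbols_norm_power_pos[OF g s]
    have "pairing u (heat t (norm_power s (fourier f))) = pairing u (heat t (fourier f))" if t: "0 \<le> t" for t
    proof -
      let ?c = "sqrt (2 * t)"
      have heat: "pairing u (heat t h) = (LINT z|lborel. of_real (gauss z) * (LINT x|lborel. u x * inverse_fourier h (x - ?c *\<^sub>R z)))"
        if h: "h \<in> good_symbols" for h
        unfolding pairing_def inverse_fourier_heat[OF good_symbols_integrable[OF h] t]
        by (rule pairing_heat_swap[OF good_symbols_integrable_inverse[OF h] measurable_u bound_u])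
      have "(LINT x|lborel. u x * inverse_fourier (norm_power s (fourier f)) (x - a))
          = (LINT x|lborel. u x * inverse_fourier (fourier f) (x - a))" for a
      proof -
        note fa = test_function_translate[OF f, of a]
        have "frac_laplacian s u (\<lambda>x. f (x - a)) = distribution_of u (\<lambda>x. f (x - a))"
          using * fa by (simp add: solves_frac_helmholtz_def)
        then have "pairing u (norm_power s (fourier (\<lambda>x. f (x - a)))) = (LINT x|lborel. u x * f (x - a))"
          by (simp add: frac_laplacian_eq_pairing distribution_of_def)
        then show ?thesis
          unfolding pairing_def inverse_fourier_multiplier_translate[OF test_function_integrable[OF f]]
          by (simp add: inverse_fourier_fourier[OF f])
      qed
      then show ?thesis by (simp only: heat[OF g] heat[OF gs])
    qed
    then show "fourier f \<in> solution_symbols s" using g by (simp add: solution_symbols_def)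
  qed
qed

text \<open>
  By Fourier inversion, \<open>(-\<Delta>)\<^sup>1\<close> acts on test functions as the classical operator; Green's identity
  moves it to \<open>u\<close>, and the fundamental lemma removes the test function.
\<close>

lemma solves_frac_helmholtz_1_iff:
  assumes u: "smooth u"
  shows "solves_frac_helmholtz 1 u \<longleftrightarrow> (\<forall>x. - laplacian u x = u x)"
proof -
  have eq: "frac_laplacian 1 u f = (LINT x|lborel. - laplacian u x * f x)" if f: "test_function f" for f
  proof -
    have "norm_power 1 (fourier f) = fourier (\<lambda>x. - laplacian f x)"
      unfolding norm_power_1 by (rule ext) (simp add: multiplier_def fourier_neg_laplacian[OF f])
    then have "frac_laplacian 1 u f = (LINT x|lborel. - (u x * laplacian f x))"
      by (simp add: frac_laplacian_eq_pairing pairing_def inverse_fourier_fourier[OF test_function_uminus[OF test_function_laplacian[OF f]]])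
    then show ?thesis using green_identity[OF u f] by simp
  qed
  show ?thesis
  proof
    assume "\<forall>x. - laplacian u x = u x"
    then show "solves_frac_helmholtz 1 u"
      by (auto simp: solves_frac_helmholtz_def eq distribution_of_def)
  next
    assume *: "solves_frac_helmholtz 1 u"
    have sl: "smooth (\<lambda>x. - laplacian u x)" by (intro smooth_uminus smooth_laplacian u)
    have "- laplacian u x - u x = 0" for x
    proof (rule fundamental_lemma[of "\<lambda>x. - laplacian u x - u x"])
      show "continuous_on UNIV (\<lambda>x. - laplacian u x - u x)"
        by (intro continuous_on_diff smooth_imp_continuous_on sl u)
      fix f :: "'a \<Rightarrow> complex" assume f: "test_function f"
      have int: "integrable lborel (\<lambda>x. v x * f x)" if v: "smooth v" for v
      proof -
        obtain R where R: "\<And>x. R < norm x \<Longrightarrow> f x = 0" and "smooth f"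
          using f by (auto simp: test_function_iff)
        with v show ?thesis
          by (intro integrable_compact_support[where R = R] continuous_on_mult smooth_imp_continuous_on) auto
      qed
      have "(LINT x|lborel. (- laplacian u x) * f x) = (LINT x|lborel. u x * f x)"
        using * f by (simp only: solves_frac_helmholtz_def eq[symmetric] distribution_of_def)
      then show "(LINT x|lborel. (- laplacian u x - u x) * f x) = 0"
        unfolding left_diff_distrib by (subst Bochner_Integration.integral_diff[OF int[OF sl] int[OF u]]) simp
    qed
    then show "\<forall>x. - laplacian u x = u x" by simp
  qed
qed

end

theorem theorem1p2:
  fixes u :: "real ^ 'n \<Rightarrow> complex" and s :: real
  assumes "smooth u" and "L_infinity u"
    and "0 < s" and "s \<le> 2"
  shows "solves_frac_helmholtz s u \<longleftrightarrow> (\<forall>x. - laplacian u x = u x)"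
proof -
  obtain C where "AE x in lborel. norm (u x) \<le> C" using assms(2) by (auto simp: L_infinity_def)
  then have "norm (u x) \<le> C" for x
    by (intro AE_lborel_continuous_le continuous_intros smooth_imp_continuous_on assms(1))
  then interpret bounded_function u C
    by unfold_locales (auto intro: smooth_imp_borel_measurable assms(1))
  have "solves_frac_helmholtz s u \<longleftrightarrow> solves_frac_helmholtz 1 u"
    using solution_symbols_imp_helmholtz[OF _ assms(3,4)] helmholtz_imp_solution_symbols[OF _ assms(3,4)]
    by (auto simp: solves_frac_helmholtz_iff assms(3))
  also have "\<dots> \<longleftrightarrow> (\<forall>x. - laplacian u x = u x)" by (rule solves_frac_helmholtz_1_iff[OF assms(1)])
  finally show ?thesis .
qed

end
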